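(* Let $\Omega\subset\mathbb{R}^d$, $d\in\{2,3\}$. There is a constant $C_{stab}>0$, independent of $h$, $\Delta t_n$, $\omega_n$, $\nu$ and of the discrete solution, such that the following holds. Let $N>1$, let $u_h^0,u_h^1\in X_h$ and let $(u_h^{n+1},p^{n+1})$, $n=1,\dots,N-1$, be given by the VSS BE-AB2 scheme. Suppose that for every $n=1,\dots,N-1$, $$1-\frac{C_{stab}\,\Delta t_n(1+\omega_n^2)}{\nu h}\,\|\nabla E^{n+1}(u_h)\|^2\geq 0 .$$ Then $$\frac12\|u_h^N\|^2+\frac14\|u_h^N-u_h^{N-1}\|^2+\frac{\nu}{4}\sum_{n=1}^{N-1}\Delta t_n\|\nabla u_h^{n+1}\|^2+\sum_{n=1}^{N-1}\frac{1}{8(1+\omega_n^2)}\big\|u_h^{n+1}-u_h^n+\omega_n(u_h^n-u_h^{n-1})\big\|^2$$ $$\leq\sum_{n=1}^{N-1}\frac{\Delta t_n}{\nu}\|f^{n+1}\|_{-1}^2+\frac12\|u_h^1\|^2+\frac14\|u_h^1-u_h^0\|^2 .$$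
   Context: $\Omega\subset\mathbb{R}^d$ is a bounded regular (polygonal/polyhedral) domain; $\|\cdot\|,(\cdot,\cdot)$ are the $L^2(\Omega)$ norm and inner product. $X=[H^1_0(\Omega)]^d$, $Q=L^2_0(\Omega)=\{q\in L^2:\int_\Omega q=0\}$. $X_h\subset X$, $Q_h\subset Q$ are conforming finite element spaces on a regular (quasi-uniform) triangulation of maximal diameter $h$, satisfying the discrete inf-sup condition and the inverse inequality $\|v_h\|\le Ch^{-1}\|\nabla v_h\|$ for all $v_h\in X_h$. $\|f\|_{-1}=\sup_{0\ne v\in X}(f,v)/\|\nabla v\|$. $b^{\ast}(u,v,w)=\tfrac12(u\cdot\nabla v,w)-\tfrac12(u\cdot\nabla w,v)$. $\nu>0$ is the viscosity. Time grid $0=t^0<t^1<\dots<t^N$, $\Delta t_n=t^{n+1}-t^n$, stepsize ratio $\omega_n=\Delta t_n/\Delta t_{n-1}$, and for a sequence $v^n$, $E^{n+1}(v)=(1+\omega_n)v^n-\omega_n v^{n-1}$. Given $f^{n+1}\in H^{-1}(\Omega)^d$, the VSS BE-AB2 scheme is: for $n=1,\dots,N-1$ find $(u_h^{n+1},p^{n+1})\in X_h\times Q_h$ with $\big(\tfrac{u_h^{n+1}-u_h^n}{\Delta t_n},v_h\big)+\nu(\nabla u_h^{n+1},\nabla v_h)+b^{\ast}(E^{n+1}(u_h),E^{n+1}(u_h),v_h)-(p^{n+1},\nabla\cdot v_h)=(f^{n+1},v_h)$ for all $v_h\in X_h$, and $(\nabla\cdot u_h^{n+1},q_h)=0$ for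 all $q_h\in Q_h$. *)

theory Defs
  imports "HOL-Analysis.Analysis"
begin

definition polyhedral_domain :: "(real^'n) set \<Rightarrow> bool" where
  "polyhedral_domain \<Omega> \<longleftrightarrow> open \<Omega> \<and> bounded \<Omega> \<and> connected \<Omega> \<and> \<Omega> \<noteq> {} \<and>
     interior (closure \<Omega>) = \<Omega> \<and>
     (\<exists>\<P>. finite \<P> \<and> (\<forall>P\<in>\<P>. polytope P) \<and> closure \<Omega> = \<Union>\<P>)"

definition L2 :: "('a::euclidean_space) set \<Rightarrow> ('a \<Rightarrow> 'b::real_normed_vector) \<Rightarrow> bool" where
  "L2 \<Omega> u \<longleftrightarrow> u \<in> borel_measurable (lebesgue_on \<Omega>) \<and>
                 integrable (lebesgue_on \<Omega>) (\<lambda>x. (norm (u x))\<^sup>2)"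

definition L2ip :: "('a::euclidean_space) set \<Rightarrow> ('a \<Rightarrow> 'b::real_inner) \<Rightarrow> ('a \<Rightarrow> 'b) \<Rightarrow> real" where
  "L2ip \<Omega> u v = (\<integral>x. u x \<bullet> v x \<partial>(lebesgue_on \<Omega>))"

definition L2norm :: "('a::euclidean_space) set \<Rightarrow> ('a \<Rightarrow> 'b::real_inner) \<Rightarrow> real" where
  "L2norm \<Omega> u = sqrt (L2ip \<Omega> u u)"

text \<open>Gradient of a differentiable vector field: entry (i,j) is the partial
  derivative of the i-th component in direction j.\<close>
definition grad_C1 :: "(real^'n \<Rightarrow> real^'n) \<Rightarrow> real^'n \<Rightarrow> real^'n^'n" where
  "grad_C1 \<phi> x = matrix (frechet_derivative \<phi> (at x))"

definition C1c :: "(real^'n) set \<Rightarrow> (real^'n \<Rightarrow> real^'n) \<Rightarrow> bool" where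
  "C1c \<Omega> \<phi> \<longleftrightarrow> (\<forall>x. \<phi> differentiable (at x)) \<and> continuous_on UNIV (grad_C1 \<phi>) \<and>
      (\<exists>K. compact K \<and> K \<subseteq> \<Omega> \<and> (\<forall>x. x \<notin> K \<longrightarrow> \<phi> x = 0))"

text \<open>u lies in H^1_0 with (weak) gradient G: u and G are L2 limits of
  C^1_c fields and of their gradients (closure of C^1_c in the H^1 norm).\<close>
definition H10_rel :: "(real^'n) set \<Rightarrow> (real^'n \<Rightarrow> real^'n) \<Rightarrow> (real^'n \<Rightarrow> real^'n^'n) \<Rightarrow> bool" where
  "H10_rel \<Omega> u G \<longleftrightarrow> L2 \<Omega> u \<and> L2 \<Omega> G \<and>
     (\<exists>\<phi>. (\<forall>k. C1c \<Omega> (\<phi> k)) \<and>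
          (\<lambda>k. L2norm \<Omega> (\<lambda>x. \<phi> k x - u x)) \<longlonglongrightarrow> 0 \<and>
          (\<lambda>k. L2norm \<Omega> (\<lambda>x. grad_C1 (\<phi> k) x - G x)) \<longlonglongrightarrow> 0)"

definition H10 :: "(real^'n) set \<Rightarrow> (real^'n \<Rightarrow> real^'n) set" where
  "H10 \<Omega> = {u. \<exists>G. H10_rel \<Omega> u G}"

definition wgrad :: "(real^'n) set \<Rightarrow> (real^'n \<Rightarrow> real^'n) \<Rightarrow> (real^'n \<Rightarrow> real^'n^'n)" where
  "wgrad \<Omega> u = (SOME G. H10_rel \<Omega> u G)"

definition wdiv :: "(real^'n) set \<Rightarrow> (real^'n \<Rightarrow> real^'n) \<Rightarrow> (real^'n \<Rightarrow> real)" where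
  "wdiv \<Omega> u = (\<lambda>x. trace (wgrad \<Omega> u x))"

definition L20 :: "(real^'n) set \<Rightarrow> (real^'n \<Rightarrow> real) set" where
  "L20 \<Omega> = {q. L2 \<Omega> q \<and> (\<integral>x. q x \<partial>(lebesgue_on \<Omega>)) = 0}"

text \<open>(u . grad v)_i = sum_j u_j d_j v_i = (grad v *v u)_i\<close>
definition bstar :: "(real^'n) set \<Rightarrow> (real^'n \<Rightarrow> real^'n) \<Rightarrow> (real^'n \<Rightarrow> real^'n) \<Rightarrow> (real^'n \<Rightarrow> real^'n) \<Rightarrow> real" where
  "bstar \<Omega> u v w = 1/2 * L2ip \<Omega> (\<lambda>x. wgrad \<Omega> v x *v u x) w
                   - 1/2 * L2ip \<Omega> (\<lambda>x. wgrad \<Omega> w x *v u x) v"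

definition Hminus1 :: "(real^'n) set \<Rightarrow> ((real^'n \<Rightarrow> real^'n) \<Rightarrow> real) \<Rightarrow> bool" where
  "Hminus1 \<Omega> f \<longleftrightarrow>
     (\<forall>v\<in>H10 \<Omega>. \<forall>w\<in>H10 \<Omega>. f (\<lambda>x. v x + w x) = f v + f w) \<and>
     (\<forall>v\<in>H10 \<Omega>. \<forall>c. f (\<lambda>x. c *\<^sub>R v x) = c * f v) \<and>
     (\<exists>K. \<forall>v\<in>H10 \<Omega>. \<bar>f v\<bar> \<le> K * L2norm \<Omega> (wgrad \<Omega> v))"

definition dualnorm :: "(real^'n) set \<Rightarrow> ((real^'n \<Rightarrow> real^'n) \<Rightarrow> real) \<Rightarrow> real" where
  "dualnorm \<Omega> f = (SUP v \<in> {v \<in> H10 \<Omega>. L2norm \<Omega> (wgrad \<Omega> v) \<noteq> 0}. f v / L2norm \<Omega> (wgrad \<Omega> v))"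

definition fspan :: "('a \<Rightarrow> 'b::real_vector) set \<Rightarrow> ('a \<Rightarrow> 'b) set" where
  "fspan B = {(\<lambda>x. \<Sum>b\<in>B. c b *\<^sub>R b x) | c. True}"

definition FE_pair :: "(real^'n) set \<Rightarrow> real \<Rightarrow> real \<Rightarrow> real \<Rightarrow>
     (real^'n \<Rightarrow> real^'n) set \<Rightarrow> (real^'n \<Rightarrow> real) set \<Rightarrow> bool" where
  "FE_pair \<Omega> h Cinv \<beta> Xh Qh \<longleftrightarrow> h > 0 \<and>
     (\<exists>BX. finite BX \<and> BX \<subseteq> H10 \<Omega> \<and> Xh = fspan BX) \<and>
     (\<exists>BQ. finite BQ \<and> BQ \<subseteq> L20 \<Omega> \<and> Qh = fspan BQ) \<and>
     (\<forall>v\<in>Xh. L2norm \<Omega> (wgrad \<Omega> v) \<le> Cinv / h * L2norm \<Omega> v) \<and>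
     (\<forall>q\<in>Qh. \<beta> * L2norm \<Omega> q \<le>
        (SUP v \<in> {v \<in> Xh. L2norm \<Omega> (wgrad \<Omega> v) \<noteq> 0}.
             L2ip \<Omega> q (wdiv \<Omega> v) / L2norm \<Omega> (wgrad \<Omega> v)))"

definition dt :: "(nat \<Rightarrow> real) \<Rightarrow> nat \<Rightarrow> real" where
  "dt t n = t (Suc n) - t n"

definition ratio :: "(nat \<Rightarrow> real) \<Rightarrow> nat \<Rightarrow> real" where
  "ratio t n = dt t n / dt t (n - 1)"

text \<open>E^{n+1}(v) = (1 + omega_n) v^n - omega_n v^{n-1}\<close>
definition Ext :: "(nat \<Rightarrow> real) \<Rightarrow> (nat \<Rightarrow> 'a \<Rightarrow> 'b::real_vector) \<Rightarrow> nat \<Rightarrow> 'a \<Rightarrow> 'b" where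
  "Ext t u n = (\<lambda>x. (1 + ratio t n) *\<^sub>R u n x - ratio t n *\<^sub>R u (n - 1) x)"

definition time_grid :: "(nat \<Rightarrow> real) \<Rightarrow> nat \<Rightarrow> bool" where
  "time_grid t N \<longleftrightarrow> t 0 = 0 \<and> (\<forall>n<N. t n < t (Suc n))"

definition VSS_BE_AB2 ::
  "(real^'n) set \<Rightarrow> (real^'n \<Rightarrow> real^'n) set \<Rightarrow> (real^'n \<Rightarrow> real) set \<Rightarrow> real \<Rightarrow>
   (nat \<Rightarrow> real) \<Rightarrow> (nat \<Rightarrow> (real^'n \<Rightarrow> real^'n) \<Rightarrow> real) \<Rightarrow> nat \<Rightarrow>
   (nat \<Rightarrow> real^'n \<Rightarrow> real^'n) \<Rightarrow> (nat \<Rightarrow> real^'n \<Rightarrow> real) \<Rightarrow> bool" where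
  "VSS_BE_AB2 \<Omega> Xh Qh \<nu> t f N u p \<longleftrightarrow>
     u 0 \<in> Xh \<and> u 1 \<in> Xh \<and>
     (\<forall>n\<in>{1..N-1}. u (n+1) \<in> Xh \<and> p (n+1) \<in> Qh \<and>
        (\<forall>v\<in>Xh.
            L2ip \<Omega> (\<lambda>x. (1 / dt t n) *\<^sub>R (u (n+1) x - u n x)) v
          + \<nu> * L2ip \<Omega> (wgrad \<Omega> (u (n+1))) (wgrad \<Omega> v)
          + bstar \<Omega> (Ext t u n) (Ext t u n) v
          - L2ip \<Omega> (p (n+1)) (wdiv \<Omega> v)
          = f (n+1) v) \<and>
        (\<forall>q\<in>Qh. L2ip \<Omega> (wdiv \<Omega> (u (n+1))) q = 0))"

end

theory Submission
  imports Defs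
begin

text \<open>
  Let \<open>U = u\<^sup>n\<^sup>+\<^sup>1\<close>, let \<open>E\<close> be the extrapolated velocity and \<open>D = U - E\<close>. Testing the scheme with \<open>U\<close>, the
  difference quotient dissipates a multiple \<open>1 / (8 (1 + \<omega>\<^sup>2))\<close> of \<open>\<bar>D\<bar>\<^sup>2\<close>, and integration by parts turns the
  convective term \<open>b\<^sup>*(E, E, U)\<close> into \<open>(E \<cdot> \<nabla>U, D) + 1/2 ((\<nabla> \<cdot> E) U, D)\<close>. In dimension 2 and 3 one has
  \<open>\<bar>e d\<bar>\<^sup>2 \<le> C \<bar>\<nabla>e\<bar>\<^sup>2 \<bar>d\<bar> \<bar>\<nabla>d\<bar>\<close> in the \<open>L\<^sup>2\<close> norm, so by the inverse inequality the convective term is at most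
  \<open>C h\<^sup>-\<^sup>1\<^sup>/\<^sup>2 \<bar>\<nabla>E\<bar> \<bar>\<nabla>U\<bar> \<bar>D\<bar>\<close>. Young's inequality and the step size condition absorb it into the
  dissipation of \<open>D\<close> and a quarter of the viscous term.

  The interpolation inequality follows from the Loomis-Whitney argument of Gagliardo and Nirenberg in
  dimension 3 and from the inequalities of Ladyzhenskaya and Poincare in dimension 2. No uniqueness of weak
  gradients is needed: integration by parts holds for every gradient obtained as a limit.
\<close>

section \<open>Integrals over slices\<close>

text \<open>The final constant is \<open>8 * K\<close>, and \<open>K\<close> has three factors.
  \<open>(1 + real CARD('d) / 2)\<^sup>2\<close> comes from the two terms of the convective
  estimate, the trace being bounded by the dimension times the matrix norm.
  \<open>sqrt (4096 + 256 * R\<^sup>2)\<close> is the interpolation constant on a domain inside the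
  ball of radius \<open>R\<close>. \<open>Cinv\<close> enters when the inverse inequality bounds the
  gradient of D by D itself. Only half a power of that gradient occurs, so D appears linearly, as
  Young's inequality requires; squaring turns the half power of 1/h into the 1/h of the step size
  condition. Two obstacles shape the proof. \<open>wgrad\<close> is selected by choice, so its
  linearity is not at hand; the analytic lemmas therefore carry a pair (field, gradient) related by
  \<open>H10_rel\<close>, and D brings a gradient of its own. The integral inequalities live in
  \<open>ennreal\<close>, where roots are awkward: they are stated for squares, fractional Hoelder
  exponents are replaced by repeated Cauchy-Schwarz, and a common factor is cancelled once compact
  support has shown it finite.\<close>

lemma power_le_imp_le_ennreal:
  fixes x y :: ennreal
  assumes le: "x ^ n \<le> y ^ n" and n: "n > 0"
  shows "x \<le> y"
proof (cases y rule: ennreal_cases)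
  case (real s)
  have "x \<noteq> top"
    using assms real by (auto simp: ennreal_power top_unique top_power_ennreal)
  then show ?thesis
  proof (cases x rule: ennreal_cases)
    case r: (real r)
    show ?thesis
      using le n real r power_le_imp_le_base[of r "n - 1" s]
      by (simp add: ennreal_power ennreal_le_iff)
  qed auto
qed auto

lemma power2_le_imp_le_ennreal:
  fixes x y :: ennreal
  shows "x\<^sup>2 \<le> y\<^sup>2 \<Longrightarrow> x \<le> y"
  using power_le_imp_le_ennreal[of x 2 y] by simp

lemma ennreal_square_root:
  fixes f :: "'a \<Rightarrow> ennreal"
  assumes [measurable]: "f \<in> borel_measurable M"
  shows "\<exists>r\<in>borel_measurable M. \<forall>x. (r x)\<^sup>2 = f x"
proof (intro bexI allI)
  let ?r = "\<lambda>x. if f x = top then top else ennreal (sqrt (enn2real (f x)))"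
  show "?r \<in> borel_measurable M"
    by measurable
  show "(?r x)\<^sup>2 = f x" for x
    by (cases "f x" rule: ennreal_cases) (auto simp: ennreal_power)
qed

text \<open>Taking the pointwise hypothesis in squared form makes the conclusion have the same
  shape, so the lemma can be iterated over successive variables without any root.\<close>

lemma nn_integral_Cauchy_Schwarz_le:
  fixes f g h :: "'a \<Rightarrow> ennreal"
  assumes f: "f \<in> borel_measurable M" and g: "g \<in> borel_measurable M"
    and le: "\<And>x. x \<in> space M \<Longrightarrow> (h x)\<^sup>2 \<le> f x * g x"
  shows "(\<integral>\<^sup>+x. h x \<partial>M)\<^sup>2 \<le> (\<integral>\<^sup>+x. f x \<partial>M) * (\<integral>\<^sup>+x. g x \<partial>M)"
proof -
  obtain r where r: "r \<in> borel_measurable M" "\<And>x. (r x)\<^sup>2 = f x"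
    using ennreal_square_root[OF f] by auto
  obtain s where s: "s \<in> borel_measurable M" "\<And>x. (s x)\<^sup>2 = g x"
    using ennreal_square_root[OF g] by auto
  have "h x \<le> r x * s x" if "x \<in> space M" for x
    using le[OF that] by (simp add: power2_le_imp_le_ennreal power_mult_distrib r s)
  then have "(\<integral>\<^sup>+x. h x \<partial>M)\<^sup>2 \<le> (\<integral>\<^sup>+x. r x * s x \<partial>M)\<^sup>2"
    by (intro power_mono nn_integral_mono) auto
  also have "\<dots> \<le> (\<integral>\<^sup>+x. f x \<partial>M) * (\<integral>\<^sup>+x. g x \<partial>M)"
    using Cauchy_Schwarz_nn_integral[OF r(1) s(1)] by (simp add: r s)
  finally show ?thesis .
qed

text \<open>Each factor omits one variable. Cauchy-Schwarz is applied in z, then y, then x; each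
  time the factor that does not depend on the current variable leaves the integral.\<close>

lemma Loomis_Whitney_3:
  fixes F1 F2 F3 :: "real \<Rightarrow> real \<Rightarrow> ennreal"
  assumes [measurable]: "case_prod F1 \<in> borel_measurable (borel \<Otimes>\<^sub>M borel)"
      "case_prod F2 \<in> borel_measurable (borel \<Otimes>\<^sub>M borel)"
      "case_prod F3 \<in> borel_measurable (borel \<Otimes>\<^sub>M borel)"
    and le: "\<And>x y z. (h x y z)\<^sup>2 \<le> F1 y z * F2 x z * F3 x y"
  shows "(\<integral>\<^sup>+x. \<integral>\<^sup>+y. \<integral>\<^sup>+z. h x y z \<partial>lborel \<partial>lborel \<partial>lborel)\<^sup>2 \<le>
    (\<integral>\<^sup>+y. \<integral>\<^sup>+z. F1 y z \<partial>lborel \<partial>lborel) * (\<integral>\<^sup>+x. \<integral>\<^sup>+z. F2 x z \<partial>lborel \<partial>lborel) *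
    (\<integral>\<^sup>+x. \<integral>\<^sup>+y. F3 x y \<partial>lborel \<partial>lborel)"
proof -
  define A1 where "A1 y = (\<integral>\<^sup>+z. F1 y z \<partial>lborel)" for y
  define A2 where "A2 x = (\<integral>\<^sup>+z. F2 x z \<partial>lborel)" for x
  define A3 where "A3 x = (\<integral>\<^sup>+y. F3 x y \<partial>lborel)" for x
  have meas [measurable]: "A1 \<in> borel_measurable borel" "A2 \<in> borel_measurable borel"
    "A3 \<in> borel_measurable borel"
    unfolding A1_def[abs_def] A2_def[abs_def] A3_def[abs_def] by measurable
  have 1: "(\<integral>\<^sup>+z. h x y z \<partial>lborel)\<^sup>2 \<le> A1 y * (A2 x * F3 x y)" for x y
  proof -
    have "(\<integral>\<^sup>+z. h x y z \<partial>lborel)\<^sup>2 \<le> (\<integral>\<^sup>+z. F1 y z \<partial>lborel) * (\<integral>\<^sup>+z. F2 x z * F3 x y \<partial>lborel)"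
      using le by (intro nn_integral_Cauchy_Schwarz_le) (auto simp: mult.assoc)
    then show ?thesis
      by (simp add: nn_integral_multc A1_def A2_def)
  qed
  have 2: "(\<integral>\<^sup>+y. \<integral>\<^sup>+z. h x y z \<partial>lborel \<partial>lborel)\<^sup>2 \<le>
      (A2 x * (\<integral>\<^sup>+y. A1 y \<partial>lborel)) * A3 x" for x
  proof -
    have "(\<integral>\<^sup>+y. \<integral>\<^sup>+z. h x y z \<partial>lborel \<partial>lborel)\<^sup>2 \<le>
        (\<integral>\<^sup>+y. A1 y \<partial>lborel) * (\<integral>\<^sup>+y. A2 x * F3 x y \<partial>lborel)"
      using 1 by (intro nn_integral_Cauchy_Schwarz_le) auto
    then show ?thesis
      by (simp add: nn_integral_cmult A3_def ac_simps)
  qed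
  have "(\<integral>\<^sup>+x. \<integral>\<^sup>+y. \<integral>\<^sup>+z. h x y z \<partial>lborel \<partial>lborel \<partial>lborel)\<^sup>2 \<le>
      (\<integral>\<^sup>+x. A2 x * (\<integral>\<^sup>+y. A1 y \<partial>lborel) \<partial>lborel) * (\<integral>\<^sup>+x. A3 x \<partial>lborel)"
    using 2 by (intro nn_integral_Cauchy_Schwarz_le) auto
  then show ?thesis
    by (simp add: nn_integral_multc A1_def A2_def A3_def ac_simps)
qed

text \<open>The enumeration of the basis is arbitrary, so instantiating it in another order changes
  the order of integration; this replaces explicit uses of Fubini below.\<close>

lemma nn_integral_lborel_Basis2:
  fixes f :: "'a::euclidean_space \<Rightarrow> ennreal"
  assumes B: "(Basis :: 'a set) = {a, b}" "a \<noteq> b"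
    and [measurable]: "f \<in> borel_measurable borel"
  shows "(\<integral>\<^sup>+x. f x \<partial>lborel) = (\<integral>\<^sup>+x. \<integral>\<^sup>+y. f (x *\<^sub>R a + y *\<^sub>R b) \<partial>lborel \<partial>lborel)"
proof -
  interpret product_sigma_finite "\<lambda>_::'a. lborel :: real measure" ..
  have "(\<integral>\<^sup>+x. f x \<partial>lborel) = (\<integral>\<^sup>+p. f (\<Sum>i\<in>{a, b}. p i *\<^sub>R i) \<partial>(\<Pi>\<^sub>M i\<in>{a, b}. lborel))"
    by (subst lborel_eq) (simp add: nn_integral_distr B)
  also have "\<dots> = (\<integral>\<^sup>+x. \<integral>\<^sup>+p. f (\<Sum>i\<in>{a, b}. (p(a := x)) i *\<^sub>R i) \<partial>(\<Pi>\<^sub>M i\<in>{b}. lborel) \<partial>lborel)"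
    using B(2) by (subst product_nn_integral_insert_rev) auto
  also have "\<dots> = (\<integral>\<^sup>+x. \<integral>\<^sup>+p. f (x *\<^sub>R a + p b *\<^sub>R b) \<partial>(\<Pi>\<^sub>M i\<in>{b}. lborel) \<partial>lborel)"
    using B(2) by simp
  also have "\<dots> = (\<integral>\<^sup>+x. \<integral>\<^sup>+y. f (x *\<^sub>R a + y *\<^sub>R b) \<partial>lborel \<partial>lborel)"
    by (intro nn_integral_cong) (subst product_nn_integral_singleton, auto)
  finally show ?thesis .
qed

lemma nn_integral_lborel_Basis3:
  fixes f :: "'a::euclidean_space \<Rightarrow> ennreal"
  assumes B: "(Basis :: 'a set) = {a, b, c}" "a \<noteq> b" "a \<noteq> c" "b \<noteq> c"
    and [measurable]: "f \<in> borel_measurable borel"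
  shows "(\<integral>\<^sup>+x. f x \<partial>lborel) =
    (\<integral>\<^sup>+x. \<integral>\<^sup>+y. \<integral>\<^sup>+z. f (x *\<^sub>R a + y *\<^sub>R b + z *\<^sub>R c) \<partial>lborel \<partial>lborel \<partial>lborel)"
proof -
  interpret product_sigma_finite "\<lambda>_::'a. lborel :: real measure" ..
  have "(\<integral>\<^sup>+x. f x \<partial>lborel) =
      (\<integral>\<^sup>+p. f (\<Sum>i\<in>{a, b, c}. p i *\<^sub>R i) \<partial>(\<Pi>\<^sub>M i\<in>{a, b, c}. lborel))"
    by (subst lborel_eq) (simp add: nn_integral_distr B)
  also have "\<dots> = (\<integral>\<^sup>+x. \<integral>\<^sup>+p. f (\<Sum>i\<in>{a, b, c}. (p(a := x)) i *\<^sub>R i)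
      \<partial>(\<Pi>\<^sub>M i\<in>{b, c}. lborel) \<partial>lborel)"
    using B by (subst product_nn_integral_insert_rev) auto
  also have "\<dots> = (\<integral>\<^sup>+x. \<integral>\<^sup>+p. f (x *\<^sub>R a + p b *\<^sub>R b + p c *\<^sub>R c)
      \<partial>(\<Pi>\<^sub>M i\<in>{b, c}. lborel) \<partial>lborel)"
    using B(2-4) by (simp add: add.assoc)
  also have "\<dots> = (\<integral>\<^sup>+x. \<integral>\<^sup>+y. \<integral>\<^sup>+p. f (x *\<^sub>R a + (p(b := y)) b *\<^sub>R b + (p(b := y)) c *\<^sub>R c)
      \<partial>(\<Pi>\<^sub>M i\<in>{c}. lborel) \<partial>lborel \<partial>lborel)"
    using B by (intro nn_integral_cong) (subst product_nn_integral_insert_rev, auto)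
  also have "\<dots> = (\<integral>\<^sup>+x. \<integral>\<^sup>+y. \<integral>\<^sup>+p. f (x *\<^sub>R a + y *\<^sub>R b + p c *\<^sub>R c)
      \<partial>(\<Pi>\<^sub>M i\<in>{c}. lborel) \<partial>lborel \<partial>lborel)"
    using B by simp
  also have "\<dots> = (\<integral>\<^sup>+x. \<integral>\<^sup>+y. \<integral>\<^sup>+z. f (x *\<^sub>R a + y *\<^sub>R b + z *\<^sub>R c) \<partial>lborel \<partial>lborel \<partial>lborel)"
    by (intro nn_integral_cong) (subst product_nn_integral_singleton, auto)
  finally show ?thesis .
qed

section \<open>Compactly supported C^1 functions along coordinate lines\<close>

lemma abs_le_nn_integral_deriv:
  fixes p p' :: "real \<Rightarrow> real"
  assumes deriv: "\<And>s. (p has_real_derivative p' s) (at s)"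
    and cont: "continuous_on UNIV p'"
    and zero: "\<And>s. \<bar>s\<bar> > R \<Longrightarrow> p s = 0"
  shows "ennreal \<bar>p x\<bar> \<le> (\<integral>\<^sup>+s. ennreal \<bar>p' s\<bar> \<partial>lborel)"
proof -
  \<comment> \<open>A starting point to the left of \<open>x\<close> and outside the support, so
    that the fundamental theorem on \<open>{a..x}\<close> yields \<open>p x\<close> itself.\<close>
  define a where "a = - \<bar>R\<bar> - \<bar>x\<bar> - 1"
  have pa: "p a = 0" and ax: "a \<le> x"
    unfolding a_def by (auto intro!: zero)
  have I: "(\<integral>s. indicator {a..x} s *\<^sub>R p' s \<partial>lborel) = p x - p a"
    using deriv ax continuous_on_subset[OF cont]
    by (intro integral_FTC_Icc)
      (auto simp: has_real_derivative_iff_has_vector_derivative[symmetric]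
        intro: has_field_derivative_at_within)
  have int: "integrable lborel (\<lambda>s. indicator {a..x} s *\<^sub>R p' s)"
    by (intro borel_integrable_compact continuous_on_subset[OF cont]) auto
  have "ennreal \<bar>p x\<bar> \<le> (\<integral>\<^sup>+s. ennreal (norm (indicator {a..x} s *\<^sub>R p' s)) \<partial>lborel)"
    using integral_norm_bound_ennreal[OF int] I pa by simp
  also have "\<dots> \<le> (\<integral>\<^sup>+s. ennreal \<bar>p' s\<bar> \<partial>lborel)"
    by (intro nn_integral_mono) (auto simp: indicator_def)
  finally show ?thesis .
qed

text \<open>\<open>D x b\<close> is the directional derivative at \<open>x\<close> along
  \<open>b\<close>. It is a parameter, not a derived object, so product rules produce it in closed
  form. Continuity is asked separately in each direction, and the support is not tied to a
  domain.\<close>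

definition C1_compact :: "('a::euclidean_space \<Rightarrow> 'b::real_normed_vector) \<Rightarrow> ('a \<Rightarrow> 'a \<Rightarrow> 'b) \<Rightarrow> bool" where
  "C1_compact g D \<longleftrightarrow> (\<forall>x. (g has_derivative D x) (at x)) \<and>
    (\<forall>b. continuous_on UNIV (\<lambda>x. D x b)) \<and> (\<exists>K. compact K \<and> (\<forall>x. x \<notin> K \<longrightarrow> g x = 0))"

lemma C1_compact_continuous: "C1_compact g D \<Longrightarrow> continuous_on UNIV g"
  unfolding C1_compact_def by (auto intro!: continuous_at_imp_continuous_on has_derivative_continuous)

lemma C1_compact_line_derivative:
  fixes g :: "'a::euclidean_space \<Rightarrow> real"
  assumes "C1_compact g D"
  shows "((\<lambda>s. g (x + s *\<^sub>R b)) has_real_derivative D (x + s *\<^sub>R b) b) (at s)"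
proof -
  have Dg: "(g has_derivative D (x + s *\<^sub>R b)) (at (x + s *\<^sub>R b))"
    using assms unfolding C1_compact_def by auto
  have "((\<lambda>s. x + s *\<^sub>R b) has_derivative (\<lambda>t. t *\<^sub>R b)) (at s)"
    by (auto intro!: derivative_eq_intros)
  then have "((\<lambda>s. g (x + s *\<^sub>R b)) has_derivative (\<lambda>t. D (x + s *\<^sub>R b) (t *\<^sub>R b))) (at s)"
    by (rule has_derivative_compose[where f' = "\<lambda>t. t *\<^sub>R b" and g' = "D (x + s *\<^sub>R b)"]) (rule Dg)
  then show ?thesis
    unfolding has_field_derivative_def
    using linear_scale[OF has_derivative_linear[OF Dg]] by (simp add: mult.commute[of _ "D _ _"])
qed

text \<open>The right-hand side no longer depends on \<open>x\<close>: the value on a line parallel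
  to \<open>b\<close> is controlled by a function of the remaining coordinates only.\<close>

lemma C1_compact_slice:
  fixes g :: "'a::euclidean_space \<Rightarrow> real"
  assumes g: "C1_compact g D" and b: "norm b = 1"
  shows "ennreal \<bar>g (x *\<^sub>R b + y)\<bar> \<le> (\<integral>\<^sup>+s. ennreal \<bar>D (s *\<^sub>R b + y) b\<bar> \<partial>lborel)"
proof -
  from g obtain K where K: "compact K" "\<And>x. x \<notin> K \<Longrightarrow> g x = 0"
    unfolding C1_compact_def by auto
  obtain R where R: "\<And>x. x \<in> K \<Longrightarrow> norm x \<le> R"
    using compact_imp_bounded[OF K(1)] by (auto simp: bounded_iff)
  show ?thesis
  proof (rule abs_le_nn_integral_deriv[where R = "R + norm y" and p = "\<lambda>s. g (s *\<^sub>R b + y)"])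
    fix s
    show "((\<lambda>s. g (s *\<^sub>R b + y)) has_real_derivative D (s *\<^sub>R b + y) b) (at s)"
      using C1_compact_line_derivative[OF g, of y b s] by (simp add: add.commute)
  next
    have "continuous_on UNIV (\<lambda>x. D x b)"
      using g unfolding C1_compact_def by auto
    then show "continuous_on UNIV (\<lambda>s. D (s *\<^sub>R b + y) b)"
      by (rule continuous_on_compose2[where t = UNIV]) (auto intro!: continuous_intros)
  next
    fix s :: real assume s: "\<bar>s\<bar> > R + norm y"
    have "norm (s *\<^sub>R b + y) \<ge> \<bar>s\<bar> - norm y"
      using norm_diff_ineq[of "s *\<^sub>R b" y] b by simp
    with s have "norm (s *\<^sub>R b + y) > R"
      by linarith
    then show "g (s *\<^sub>R b + y) = 0"
      using R K(2) not_le by blast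
  qed
qed

text \<open>One product rule for real products and inner products; it supplies the derivatives of
  squares and fourth powers of norms and of the field that is integrated by parts.\<close>

lemma C1_compact_bilinear:
  fixes f :: "'a::euclidean_space \<Rightarrow> 'b::real_normed_vector"
    and prod :: "'b \<Rightarrow> 'c::real_normed_vector \<Rightarrow> 'd::real_normed_vector"
  assumes bil: "bounded_bilinear prod" and f: "C1_compact f D" and g: "C1_compact g E"
  shows "C1_compact (\<lambda>x. prod (f x) (g x)) (\<lambda>x h. prod (f x) (E x h) + prod (D x h) (g x))"
proof -
  interpret bounded_bilinear prod by fact
  have "continuous_on UNIV f" "continuous_on UNIV g"
    using f g by (auto intro: C1_compact_continuous)
  moreover obtain K where "compact K" "\<And>x. x \<notin> K \<Longrightarrow> f x = 0"
    using f unfolding C1_compact_def by auto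
  ultimately show ?thesis
    using f g unfolding C1_compact_def
    by (auto intro!: FDERIV continuous_on continuous_intros simp: zero_left)
qed

lemma C1_compact_borel:
  assumes "C1_compact g D"
  shows "g \<in> borel_measurable borel" "(\<lambda>x. D x b) \<in> borel_measurable borel"
  using assms C1_compact_continuous[OF assms] unfolding C1_compact_def
  by (auto intro: borel_measurable_continuous_onI)

text \<open>Bounding \<open>g\<close> along \<open>a\<close> gives a function of the second
  coordinate, bounding \<open>k\<close> along \<open>b\<close> a function of the first. The product
  then separates and the double integral factorizes.\<close>

lemma Ladyzhenskaya_slices:
  fixes g k :: "'a::euclidean_space \<Rightarrow> real"
  assumes B: "(Basis :: 'a set) = {a, b}" "a \<noteq> b"
    and g: "C1_compact g D" and k: "C1_compact k E"
  shows "(\<integral>\<^sup>+x. ennreal \<bar>g x * k x\<bar> \<partial>lborel) \<le>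
    (\<integral>\<^sup>+x. ennreal \<bar>D x a\<bar> \<partial>lborel) * (\<integral>\<^sup>+x. ennreal \<bar>E x b\<bar> \<partial>lborel)"
proof -
  note [measurable] = C1_compact_borel[OF g] C1_compact_borel[OF k]
  have n: "norm a = 1" "norm b = 1"
    using B(1) norm_Basis by auto
  define A where "A y = (\<integral>\<^sup>+s. ennreal \<bar>D (s *\<^sub>R a + y *\<^sub>R b) a\<bar> \<partial>lborel)" for y
  define A' where "A' x = (\<integral>\<^sup>+s. ennreal \<bar>E (x *\<^sub>R a + s *\<^sub>R b) b\<bar> \<partial>lborel)" for x
  have [measurable]: "A \<in> borel_measurable borel" "A' \<in> borel_measurable borel"
    unfolding A_def[abs_def] A'_def[abs_def] by measurable
  have le: "ennreal \<bar>g (x *\<^sub>R a + y *\<^sub>R b) * k (x *\<^sub>R a + y *\<^sub>R b)\<bar> \<le> A y * A' x" for x y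
    using C1_compact_slice[OF g n(1), of x "y *\<^sub>R b"] C1_compact_slice[OF k n(2), of y "x *\<^sub>R a"]
    unfolding A_def A'_def
    by (simp add: abs_mult ennreal_mult mult_mono add.commute)
  have "(\<integral>\<^sup>+x. ennreal \<bar>g x * k x\<bar> \<partial>lborel) \<le> (\<integral>\<^sup>+x. \<integral>\<^sup>+y. A y * A' x \<partial>lborel \<partial>lborel)"
    using le by (subst nn_integral_lborel_Basis2[OF B]) (auto intro!: nn_integral_mono)
  also have "\<dots> = (\<integral>\<^sup>+y. A y \<partial>lborel) * (\<integral>\<^sup>+x. A' x \<partial>lborel)"
    by (simp add: nn_integral_multc nn_integral_cmult)
  also have "(\<integral>\<^sup>+y. A y \<partial>lborel) = (\<integral>\<^sup>+x. ennreal \<bar>D x a\<bar> \<partial>lborel)"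
    unfolding A_def using B
    by (subst nn_integral_lborel_Basis2[where a = b and b = a]) (auto simp: insert_commute add.commute)
  also have "(\<integral>\<^sup>+x. A' x \<partial>lborel) = (\<integral>\<^sup>+x. ennreal \<bar>E x b\<bar> \<partial>lborel)"
    unfolding A'_def by (subst nn_integral_lborel_Basis2[OF B]) auto
  finally show ?thesis .
qed

text \<open>On each line parallel to \<open>a\<close> the slice bound is constant, and
  \<open>g\<close> vanishes there unless the coordinate lies in an interval of length
  \<open>2 * R\<close>.\<close>

lemma Poincare_slices:
  fixes g :: "'a::euclidean_space \<Rightarrow> real"
  assumes B: "(Basis :: 'a set) = {a, b}" "a \<noteq> b"
    and g: "C1_compact g D" and R: "R \<ge> 0" "\<And>x. norm x > R \<Longrightarrow> g x = 0"
  shows "(\<integral>\<^sup>+x. ennreal \<bar>g x\<bar> \<partial>lborel) \<le> ennreal (2 * R) * (\<integral>\<^sup>+x. ennreal \<bar>D x a\<bar> \<partial>lborel)"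
proof -
  note [measurable] = C1_compact_borel[OF g]
  have n: "norm a = 1" "norm b = 1"
    using B(1) norm_Basis by auto
  have ab: "a \<bullet> b = 0" "a \<bullet> a = 1"
    using B inner_Basis[of a b] n(1) by (auto simp: norm_eq_1)
  define A where "A y = (\<integral>\<^sup>+s. ennreal \<bar>D (s *\<^sub>R a + y *\<^sub>R b) a\<bar> \<partial>lborel)" for y
  have [measurable]: "A \<in> borel_measurable borel"
    unfolding A_def[abs_def] by measurable
  have le: "ennreal \<bar>g (x *\<^sub>R a + y *\<^sub>R b)\<bar> \<le> A y * indicator {-R..R} x" for x y
  proof (cases "\<bar>x\<bar> \<le> R")
    case True
    then show ?thesis
      using C1_compact_slice[OF g n(1), of x "y *\<^sub>R b"] unfolding A_def by (auto simp: indicator_def)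
  next
    case False
    \<comment> \<open>By orthonormality \<open>x\<close> is the inner product with \<open>a\<close>,
      so a point with a large first coordinate lies outside the ball that contains the
      support.\<close>
    have "\<bar>x\<bar> \<le> norm (x *\<^sub>R a + y *\<^sub>R b)"
      using Cauchy_Schwarz_ineq2[of "x *\<^sub>R a + y *\<^sub>R b" a] n ab
      by (simp add: inner_add_left inner_commute[of b a])
    then show ?thesis
      using False R(2) by simp
  qed
  have "(\<integral>\<^sup>+x. ennreal \<bar>g x\<bar> \<partial>lborel) \<le> (\<integral>\<^sup>+x. \<integral>\<^sup>+y. A y * indicator {-R..R} x \<partial>lborel \<partial>lborel)"
    using le by (subst nn_integral_lborel_Basis2[OF B]) (auto intro!: nn_integral_mono)
  also have "\<dots> = (\<integral>\<^sup>+y. A y \<partial>lborel) * ennreal (2 * R)"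
    using R by (simp add: nn_integral_multc nn_integral_cmult)
  also have "(\<integral>\<^sup>+y. A y \<partial>lborel) = (\<integral>\<^sup>+x. ennreal \<bar>D x a\<bar> \<partial>lborel)"
    unfolding A_def using B
    by (subst nn_integral_lborel_Basis2[where a = b and b = a]) (auto simp: insert_commute add.commute)
  finally show ?thesis
    by (simp add: mult.commute)
qed

text \<open>\<open>H\<close> stands for the power 3/2 of the absolute value of \<open>g\<close>,
  specified through its square to avoid the root. Multiplying the slice bounds in the three
  directions bounds the cube of \<open>g\<close> by a Loomis-Whitney product.\<close>

lemma Gagliardo_slices:
  fixes g :: "'a::euclidean_space \<Rightarrow> real"
  assumes B: "(Basis :: 'a set) = {a, b, c}" "a \<noteq> b" "a \<noteq> c" "b \<noteq> c"
    and g: "C1_compact g D" and H: "H \<in> borel_measurable borel" "\<And>x. (H x)\<^sup>2 = ennreal (\<bar>g x\<bar> ^ 3)"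
  shows "(\<integral>\<^sup>+x. H x \<partial>lborel)\<^sup>2 \<le> (\<integral>\<^sup>+x. ennreal \<bar>D x a\<bar> \<partial>lborel) *
    (\<integral>\<^sup>+x. ennreal \<bar>D x b\<bar> \<partial>lborel) * (\<integral>\<^sup>+x. ennreal \<bar>D x c\<bar> \<partial>lborel)"
proof -
  note [measurable] = C1_compact_borel[OF g] H(1)
  have n: "norm a = 1" "norm b = 1" "norm c = 1"
    using B(1) norm_Basis by auto
  define F1 where "F1 y z = (\<integral>\<^sup>+s. ennreal \<bar>D (y *\<^sub>R b + z *\<^sub>R c + s *\<^sub>R a) a\<bar> \<partial>lborel)" for y z
  define F2 where "F2 x z = (\<integral>\<^sup>+s. ennreal \<bar>D (x *\<^sub>R a + z *\<^sub>R c + s *\<^sub>R b) b\<bar> \<partial>lborel)" for x z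
  define F3 where "F3 x y = (\<integral>\<^sup>+s. ennreal \<bar>D (x *\<^sub>R a + y *\<^sub>R b + s *\<^sub>R c) c\<bar> \<partial>lborel)" for x y
  have m: "case_prod F1 \<in> borel_measurable (borel \<Otimes>\<^sub>M borel)"
      "case_prod F2 \<in> borel_measurable (borel \<Otimes>\<^sub>M borel)"
      "case_prod F3 \<in> borel_measurable (borel \<Otimes>\<^sub>M borel)"
    unfolding F1_def[abs_def] F2_def[abs_def] F3_def[abs_def] by measurable
  have le: "(H (x *\<^sub>R a + y *\<^sub>R b + z *\<^sub>R c))\<^sup>2 \<le> F1 y z * F2 x z * F3 x y" for x y z
  proof -
    let ?p = "x *\<^sub>R a + y *\<^sub>R b + z *\<^sub>R c"
    have "ennreal \<bar>g ?p\<bar> \<le> F1 y z" "ennreal \<bar>g ?p\<bar> \<le> F2 x z" "ennreal \<bar>g ?p\<bar> \<le> F3 x y"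
      unfolding F1_def F2_def F3_def
      using C1_compact_slice[OF g n(1), of x "y *\<^sub>R b + z *\<^sub>R c"]
        C1_compact_slice[OF g n(2), of y "x *\<^sub>R a + z *\<^sub>R c"]
        C1_compact_slice[OF g n(3), of z "x *\<^sub>R a + y *\<^sub>R b"]
      by (simp_all add: ac_simps)
    then have "ennreal \<bar>g ?p\<bar> * ennreal \<bar>g ?p\<bar> * ennreal \<bar>g ?p\<bar> \<le> F1 y z * F2 x z * F3 x y"
      by (intro mult_mono) auto
    then show ?thesis
      by (simp add: H(2) power3_eq_cube flip: ennreal_mult)
  qed
  have 1: "(\<integral>\<^sup>+y. \<integral>\<^sup>+z. F1 y z \<partial>lborel \<partial>lborel) = (\<integral>\<^sup>+x. ennreal \<bar>D x a\<bar> \<partial>lborel)"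
    unfolding F1_def using B
    by (subst nn_integral_lborel_Basis3[where a = b and b = c and c = a]) auto
  have 2: "(\<integral>\<^sup>+x. \<integral>\<^sup>+z. F2 x z \<partial>lborel \<partial>lborel) = (\<integral>\<^sup>+x. ennreal \<bar>D x b\<bar> \<partial>lborel)"
    unfolding F2_def using B
    by (subst nn_integral_lborel_Basis3[where a = a and b = c and c = b]) auto
  have 3: "(\<integral>\<^sup>+x. \<integral>\<^sup>+y. F3 x y \<partial>lborel \<partial>lborel) = (\<integral>\<^sup>+x. ennreal \<bar>D x c\<bar> \<partial>lborel)"
    unfolding F3_def using B
    by (subst nn_integral_lborel_Basis3[where a = a and b = b and c = c]) auto
  have "(\<integral>\<^sup>+x. H x \<partial>lborel)\<^sup>2 =
     (\<integral>\<^sup>+x. \<integral>\<^sup>+y. \<integral>\<^sup>+z. H (x *\<^sub>R a + y *\<^sub>R b + z *\<^sub>R c) \<partial>lborel \<partial>lborel \<partial>lborel)\<^sup>2"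
    by (subst nn_integral_lborel_Basis3[OF B]) auto
  also have "\<dots> \<le> (\<integral>\<^sup>+x. ennreal \<bar>D x a\<bar> \<partial>lborel) *
    (\<integral>\<^sup>+x. ennreal \<bar>D x b\<bar> \<partial>lborel) * (\<integral>\<^sup>+x. ennreal \<bar>D x c\<bar> \<partial>lborel)"
    using Loomis_Whitney_3[OF m le] unfolding 1 2 3 .
  finally show ?thesis .
qed

section \<open>Interpolation for smooth fields\<close>

lemma C1_compact_norm_sq:
  fixes \<phi> :: "'a::euclidean_space \<Rightarrow> 'b::real_inner"
  assumes "C1_compact \<phi> D"
  shows "C1_compact (\<lambda>x. (norm (\<phi> x))\<^sup>2) (\<lambda>x h. 2 * (\<phi> x \<bullet> D x h))"
proof -
  have "(\<lambda>x h. \<phi> x \<bullet> D x h + D x h \<bullet> \<phi> x) = (\<lambda>x h. 2 * (\<phi> x \<bullet> D x h))"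
    by (intro ext) (subst inner_commute, simp)
  then show ?thesis
    using C1_compact_bilinear[OF bounded_bilinear_inner assms assms]
    by (simp add: power2_norm_eq_inner)
qed

lemma C1_compact_norm_4:
  fixes \<phi> :: "'a::euclidean_space \<Rightarrow> 'b::real_inner"
  assumes "C1_compact \<phi> D"
  shows "C1_compact (\<lambda>x. norm (\<phi> x) ^ 4) (\<lambda>x h. 4 * (norm (\<phi> x))\<^sup>2 * (\<phi> x \<bullet> D x h))"
proof -
  have "(norm (\<phi> x))\<^sup>2 * (norm (\<phi> x))\<^sup>2 = norm (\<phi> x) ^ 4" for x
    by (simp flip: power_add)
  then show ?thesis
    using C1_compact_bilinear[OF bounded_bilinear_mult C1_compact_norm_sq[OF assms]
        C1_compact_norm_sq[OF assms]]
    by (simp add: algebra_simps)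
qed

lemma C1_compact_power_integrable:
  fixes \<phi> :: "'a::euclidean_space \<Rightarrow> 'b::real_normed_vector"
  assumes "C1_compact \<phi> D" "k > 0"
  shows "(\<integral>\<^sup>+x. ennreal (norm (\<phi> x) ^ k) \<partial>lborel) < top"
proof -
  obtain K where K: "compact K" "\<And>x. x \<notin> K \<Longrightarrow> \<phi> x = 0"
    using assms unfolding C1_compact_def by auto
  have "integrable lborel (\<lambda>x. indicator K x *\<^sub>R norm (\<phi> x) ^ k)"
    using K(1) continuous_on_subset[OF C1_compact_continuous[OF assms(1)]]
    by (intro borel_integrable_compact continuous_intros) auto
  moreover have "(\<lambda>x. indicator K x *\<^sub>R norm (\<phi> x) ^ k) = (\<lambda>x. norm (\<phi> x) ^ k)"
    using K(2) assms(2) by (fastforce simp: indicator_def)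
  ultimately have "integrable lborel (\<lambda>x. norm (\<phi> x) ^ k)"
    by (simp only:)
  then show ?thesis
    by (simp add: integrable_iff_bounded)
qed

text \<open>Cauchy-Schwarz separates the powers of the field from its derivative. The cases needed
  are \<open>c = 4\<close>, \<open>k = 2\<close> (derivative of the fourth power of the norm) and
  \<open>c = 2\<close>, \<open>k = 0\<close> (derivative of its square). \<open>N\<close> will be
  the norm of the gradient matrix.\<close>

lemma nn_integral_norm_derivative_sq_le:
  fixes \<phi> :: "'a::euclidean_space \<Rightarrow> 'b::real_inner"
  assumes \<phi>: "C1_compact \<phi> D" and N [measurable]: "N \<in> borel_measurable borel"
    and le: "\<And>x. norm (D x b) \<le> N x" and c: "c \<ge> 0"
  shows "(\<integral>\<^sup>+x. ennreal \<bar>c * norm (\<phi> x) ^ k * (\<phi> x \<bullet> D x b)\<bar> \<partial>lborel)\<^sup>2 \<le>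
    ennreal (c\<^sup>2) * (\<integral>\<^sup>+x. ennreal (norm (\<phi> x) ^ (2 * Suc k)) \<partial>lborel) * (\<integral>\<^sup>+x. ennreal ((N x)\<^sup>2) \<partial>lborel)"
proof -
  have [measurable]: "(\<lambda>x. norm (\<phi> x)) \<in> borel_measurable borel"
    using C1_compact_continuous[OF \<phi>] by (intro borel_measurable_continuous_onI continuous_intros)
  have pt: "(ennreal \<bar>c * norm (\<phi> x) ^ k * (\<phi> x \<bullet> D x b)\<bar>)\<^sup>2 \<le>
      (ennreal (c\<^sup>2) * ennreal (norm (\<phi> x) ^ (2 * Suc k))) * ennreal ((N x)\<^sup>2)" for x
  proof -
    have "\<bar>\<phi> x \<bullet> D x b\<bar> \<le> norm (\<phi> x) * N x"
      using Cauchy_Schwarz_ineq2[of "\<phi> x" "D x b"] mult_left_mono[OF le[of x], of "norm (\<phi> x)"] by simp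
    then have "c * norm (\<phi> x) ^ k * \<bar>\<phi> x \<bullet> D x b\<bar> \<le> c * norm (\<phi> x) ^ k * (norm (\<phi> x) * N x)"
      using c by (intro mult_left_mono) auto
    then have "\<bar>c * norm (\<phi> x) ^ k * (\<phi> x \<bullet> D x b)\<bar> \<le> c * norm (\<phi> x) ^ Suc k * N x"
      using c by (simp add: abs_mult mult_ac)
    then have "\<bar>c * norm (\<phi> x) ^ k * (\<phi> x \<bullet> D x b)\<bar>\<^sup>2 \<le> (c * norm (\<phi> x) ^ Suc k * N x)\<^sup>2"
      by (intro power_mono) auto
    also have "\<dots> = c\<^sup>2 * norm (\<phi> x) ^ (2 * Suc k) * (N x)\<^sup>2"
      by (simp add: power_mult_distrib power_mult[symmetric] mult.commute[of _ 2] del: power_Suc mult_Suc_right)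
    finally show ?thesis
      by (simp add: ennreal_power flip: ennreal_mult)
  qed
  have "(\<integral>\<^sup>+x. ennreal \<bar>c * norm (\<phi> x) ^ k * (\<phi> x \<bullet> D x b)\<bar> \<partial>lborel)\<^sup>2 \<le>
      (\<integral>\<^sup>+x. ennreal (c\<^sup>2) * ennreal (norm (\<phi> x) ^ (2 * Suc k)) \<partial>lborel) *
      (\<integral>\<^sup>+x. ennreal ((N x)\<^sup>2) \<partial>lborel)"
    by (intro nn_integral_Cauchy_Schwarz_le pt) measurable
  also have "(\<integral>\<^sup>+x. ennreal (c\<^sup>2) * ennreal (norm (\<phi> x) ^ (2 * Suc k)) \<partial>lborel) =
      ennreal (c\<^sup>2) * (\<integral>\<^sup>+x. ennreal (norm (\<phi> x) ^ (2 * Suc k)) \<partial>lborel)"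
    by (intro nn_integral_cmult) measurable
  finally show ?thesis .
qed

lemma ennreal_self_square_le:
  fixes x y :: ennreal
  assumes "x * x \<le> x * y" "x < top"
  shows "x \<le> y"
  using assms by (cases "x = 0") (auto simp: ennreal_mult_le_mult_iff)

text \<open>The fourth power of the norm is the right input for the slice inequality: its power 3/2
  is the sixth power sought. Each \<open>J i\<close> has square at most \<open>16 * ?S * ?G\<close>,
  so the integral \<open>?S\<close> returns on the right with a lower exponent.\<close>

lemma Gagliardo_Nirenberg_Sobolev_3:
  fixes \<phi> :: "'a::euclidean_space \<Rightarrow> 'b::real_inner"
  assumes dim: "DIM('a) = 3"
    and \<phi>: "C1_compact \<phi> D" and N [measurable]: "N \<in> borel_measurable borel"
    and le: "\<And>x b. b \<in> Basis \<Longrightarrow> norm (D x b) \<le> N x"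
  shows "(\<integral>\<^sup>+x. ennreal (norm (\<phi> x) ^ 6) \<partial>lborel) \<le> (16 * (\<integral>\<^sup>+x. ennreal ((N x)\<^sup>2) \<partial>lborel)) ^ 3"
proof -
  let ?S = "\<integral>\<^sup>+x. ennreal (norm (\<phi> x) ^ 6) \<partial>lborel" and ?G = "\<integral>\<^sup>+x. ennreal ((N x)\<^sup>2) \<partial>lborel"
  obtain a b c :: 'a where B: "Basis = {a, b, c}" "a \<noteq> b" "a \<noteq> c" "b \<noteq> c"
    using dim by (auto simp: card_3_iff)
  define J where "J b = (\<integral>\<^sup>+x. ennreal \<bar>4 * (norm (\<phi> x))\<^sup>2 * (\<phi> x \<bullet> D x b)\<bar> \<partial>lborel)" for b
  have J: "(J i)\<^sup>2 \<le> 16 * ?S * ?G" if "i \<in> Basis" for i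
    using nn_integral_norm_derivative_sq_le[OF \<phi> N le[OF that], of 4 2] unfolding J_def by simp
  have [measurable]: "\<phi> \<in> borel_measurable borel"
    using C1_compact_borel[OF \<phi>] by simp
  have "(ennreal (norm (\<phi> x) ^ 6))\<^sup>2 = ennreal (\<bar>norm (\<phi> x) ^ 4\<bar> ^ 3)" for x
    by (simp add: ennreal_power power_mult[symmetric])
  then have "?S\<^sup>2 \<le> J a * J b * J c"
    unfolding J_def by (intro Gagliardo_slices[OF B C1_compact_norm_4[OF \<phi>]]) measurable
  then have "(?S\<^sup>2)\<^sup>2 \<le> (J a * J b * J c)\<^sup>2"
    by (intro power_mono) auto
  also have "\<dots> = (J a)\<^sup>2 * (J b)\<^sup>2 * (J c)\<^sup>2"
    by (simp add: power_mult_distrib)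
  also have "\<dots> \<le> (16 * ?S * ?G) * (16 * ?S * ?G) * (16 * ?S * ?G)"
    using B(1) by (intro mult_mono J) auto
  \<comment> \<open>The left side is the fourth power of \<open>?S\<close>, the right side contains
    its cube; cancelling the cube needs \<open>?S\<close> finite, which compact support
    gives.\<close>
  finally have "?S ^ 3 * ?S \<le> ?S ^ 3 * (16 * ?G) ^ 3"
    by (simp add: power_mult_distrib power2_eq_square power3_eq_cube mult_ac)
  moreover have "?S < top"
    using C1_compact_power_integrable[OF \<phi>, of 6] by simp
  ultimately show ?thesis
    by (cases "?S = 0") (auto simp: ennreal_mult_le_mult_iff power_less_top_ennreal power_eq_top_ennreal)
qed

lemma nn_integral_Cauchy_Schwarz_real:
  fixes f g h :: "'a \<Rightarrow> real"
  assumes "f \<in> borel_measurable M" "g \<in> borel_measurable M"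
    and eq: "\<And>x. (h x)\<^sup>2 = f x * g x" and nonneg: "\<And>x. 0 \<le> f x" "\<And>x. 0 \<le> g x" "\<And>x. 0 \<le> h x"
  shows "(\<integral>\<^sup>+x. ennreal (h x) \<partial>M)\<^sup>2 \<le> (\<integral>\<^sup>+x. ennreal (f x) \<partial>M) * (\<integral>\<^sup>+x. ennreal (g x) \<partial>M)"
proof (rule nn_integral_Cauchy_Schwarz_le)
  show "(ennreal (h x))\<^sup>2 \<le> ennreal (f x) * ennreal (g x)" for x
    using nonneg by (simp add: ennreal_power eq ennreal_mult)
qed (use assms in measurable)

text \<open>After one Cauchy-Schwarz it remains to bound \<open>P\<close>, which Hoelder with
  exponents 3/2 and 3 would do. The auxiliary integral \<open>Q\<close> replaces it:
  \<open>P^2 <= a Q\<close> and \<open>Q^2 <= b P\<close> give \<open>P^4 <= a^2 b P\<close>, with a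
  and b the integrals of the sixth powers. The constant 4096 is \<open>16 ^ 3\<close>.\<close>

lemma interpolation_dim_3:
  fixes \<phi> :: "'a::euclidean_space \<Rightarrow> 'b::real_inner" and \<psi> :: "'a \<Rightarrow> 'b"
  assumes dim: "DIM('a) = 3"
    and \<phi>: "C1_compact \<phi> D" "N \<in> borel_measurable borel" "\<And>x b. b \<in> Basis \<Longrightarrow> norm (D x b) \<le> N x"
    and \<psi>: "C1_compact \<psi> E" "N' \<in> borel_measurable borel" "\<And>x b. b \<in> Basis \<Longrightarrow> norm (E x b) \<le> N' x"
  shows "(\<integral>\<^sup>+x. ennreal ((norm (\<phi> x) * norm (\<psi> x))\<^sup>2) \<partial>lborel)\<^sup>2 \<le>
    4096 * (\<integral>\<^sup>+x. ennreal ((N x)\<^sup>2) \<partial>lborel)\<^sup>2 *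
      (\<integral>\<^sup>+x. ennreal ((norm (\<psi> x))\<^sup>2) \<partial>lborel) * (\<integral>\<^sup>+x. ennreal ((N' x)\<^sup>2) \<partial>lborel)"
proof -
  have reassoc: "((16 * x) ^ 3)\<^sup>2 * ((16 * y) ^ 3 * p) = p * (4096 * x\<^sup>2 * y) ^ 3" for x y p :: ennreal
    by (simp add: power_mult_distrib ac_simps flip: power_mult)
  have [measurable]: "\<phi> \<in> borel_measurable borel" "\<psi> \<in> borel_measurable borel"
    using C1_compact_borel[OF \<phi>(1)] C1_compact_borel[OF \<psi>(1)] by simp_all
  let ?G = "\<integral>\<^sup>+x. ennreal ((N x)\<^sup>2) \<partial>lborel" and ?G' = "\<integral>\<^sup>+x. ennreal ((N' x)\<^sup>2) \<partial>lborel"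
  let ?a = "\<integral>\<^sup>+x. ennreal (norm (\<phi> x) ^ 6) \<partial>lborel" and ?b = "\<integral>\<^sup>+x. ennreal (norm (\<psi> x) ^ 6) \<partial>lborel"
  define P where "P = (\<integral>\<^sup>+x. ennreal (norm (\<phi> x) ^ 4 * (norm (\<psi> x))\<^sup>2) \<partial>lborel)"
  define Q where "Q = (\<integral>\<^sup>+x. ennreal ((norm (\<phi> x))\<^sup>2 * norm (\<psi> x) ^ 4) \<partial>lborel)"
  have I: "(\<integral>\<^sup>+x. ennreal ((norm (\<phi> x) * norm (\<psi> x))\<^sup>2) \<partial>lborel)\<^sup>2 \<le>
      (\<integral>\<^sup>+x. ennreal ((norm (\<psi> x))\<^sup>2) \<partial>lborel) * P"
    unfolding P_def
    by (rule nn_integral_Cauchy_Schwarz_real) (measurable, algebra, simp_all)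
  have PQ: "P\<^sup>2 \<le> ?a * Q"
    unfolding P_def Q_def
    by (rule nn_integral_Cauchy_Schwarz_real) (measurable, algebra, simp_all)
  have QP: "Q\<^sup>2 \<le> ?b * P"
    unfolding P_def Q_def
    by (rule nn_integral_Cauchy_Schwarz_real) (measurable, algebra, simp_all)
  \<comment> \<open>Only the finiteness of \<open>P\<close> is wanted here, so that one factor
    \<open>P\<close> can be cancelled below.\<close>
  have "C1_compact (\<lambda>x. norm (\<phi> x) ^ 4 * (norm (\<psi> x))\<^sup>2)
      (\<lambda>x h. norm (\<phi> x) ^ 4 * (2 * (\<psi> x \<bullet> E x h)) + 4 * (norm (\<phi> x))\<^sup>2 * (\<phi> x \<bullet> D x h) * (norm (\<psi> x))\<^sup>2)"
    by (rule C1_compact_bilinear[OF bounded_bilinear_mult C1_compact_norm_4[OF \<phi>(1)]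
          C1_compact_norm_sq[OF \<psi>(1)]])
  from C1_compact_power_integrable[OF this, of 1] have fin: "P < top"
    by (simp add: P_def)
  have "(P\<^sup>2)\<^sup>2 \<le> (?a * Q)\<^sup>2"
    using PQ by (rule power_mono) simp
  also have "\<dots> \<le> ?a\<^sup>2 * (?b * P)"
    unfolding power_mult_distrib using QP by (rule mult_left_mono) simp
  also have "\<dots> \<le> ((16 * ?G) ^ 3)\<^sup>2 * ((16 * ?G') ^ 3 * P)"
    using Gagliardo_Nirenberg_Sobolev_3[OF dim \<phi>] Gagliardo_Nirenberg_Sobolev_3[OF dim \<psi>]
    by (intro mult_mono power_mono) auto
  also have "\<dots> = P * (4096 * ?G\<^sup>2 * ?G') ^ 3"
    by (rule reassoc)
  also have "(P\<^sup>2)\<^sup>2 = P * P ^ 3"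
    by (simp add: power2_eq_square power3_eq_cube mult.assoc)
  finally have "P * P ^ 3 \<le> P * (4096 * ?G\<^sup>2 * ?G') ^ 3" .
  then have "P ^ 3 \<le> (4096 * ?G\<^sup>2 * ?G') ^ 3"
    using fin by (cases "P = 0") (auto simp: ennreal_mult_le_mult_iff)
  then have "P \<le> 4096 * ?G\<^sup>2 * ?G'"
    by (rule power_le_imp_le_ennreal) simp
  then have "(\<integral>\<^sup>+x. ennreal ((norm (\<psi> x))\<^sup>2) \<partial>lborel) * P \<le>
      (\<integral>\<^sup>+x. ennreal ((norm (\<psi> x))\<^sup>2) \<partial>lborel) * (4096 * ?G\<^sup>2 * ?G')"
    by (rule mult_left_mono) simp
  with I show ?thesis
    by (simp add: mult_ac)
qed

text \<open>The slice inequality for the two squared norms leaves the L2 norms of both fields on the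
  right. That of the first field is traded for its gradient by a Poincare inequality, which brings
  in \<open>R\<close> and gives the same form as in dimension 3.\<close>

lemma interpolation_dim_2:
  fixes \<phi> :: "'a::euclidean_space \<Rightarrow> 'b::real_inner" and \<psi> :: "'a \<Rightarrow> 'b"
  assumes dim: "DIM('a) = 2"
    and \<phi>: "C1_compact \<phi> D" "N \<in> borel_measurable borel" "\<And>x b. b \<in> Basis \<Longrightarrow> norm (D x b) \<le> N x"
    and \<psi>: "C1_compact \<psi> E" "N' \<in> borel_measurable borel" "\<And>x b. b \<in> Basis \<Longrightarrow> norm (E x b) \<le> N' x"
    and R: "R \<ge> 0" "\<And>x. norm x > R \<Longrightarrow> \<phi> x = 0"
  shows "(\<integral>\<^sup>+x. ennreal ((norm (\<phi> x) * norm (\<psi> x))\<^sup>2) \<partial>lborel)\<^sup>2 \<le>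
    ennreal (256 * R\<^sup>2) * (\<integral>\<^sup>+x. ennreal ((N x)\<^sup>2) \<partial>lborel)\<^sup>2 *
      (\<integral>\<^sup>+x. ennreal ((norm (\<psi> x))\<^sup>2) \<partial>lborel) * (\<integral>\<^sup>+x. ennreal ((N' x)\<^sup>2) \<partial>lborel)"
proof -
  have reassoc: "(4 * (x * a) * a) * (4 * c * d) = (16 * x) * a\<^sup>2 * c * d" for x a c d :: ennreal
    by (simp add: power2_eq_square ac_simps)
  obtain a b :: 'a where B: "Basis = {a, b}" "a \<noteq> b"
    using dim by (auto simp: card_2_iff)
  then have ab: "a \<in> Basis" "b \<in> Basis"
    by auto
  let ?G = "\<integral>\<^sup>+x. ennreal ((N x)\<^sup>2) \<partial>lborel" and ?G' = "\<integral>\<^sup>+x. ennreal ((N' x)\<^sup>2) \<partial>lborel"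
  let ?S = "\<integral>\<^sup>+x. ennreal ((norm (\<phi> x))\<^sup>2) \<partial>lborel" and ?S' = "\<integral>\<^sup>+x. ennreal ((norm (\<psi> x))\<^sup>2) \<partial>lborel"
  define J where "J = (\<integral>\<^sup>+x. ennreal \<bar>2 * (\<phi> x \<bullet> D x a)\<bar> \<partial>lborel)"
  define J' where "J' = (\<integral>\<^sup>+x. ennreal \<bar>2 * (\<psi> x \<bullet> E x b)\<bar> \<partial>lborel)"
  have J: "J\<^sup>2 \<le> 4 * ?S * ?G" "J'\<^sup>2 \<le> 4 * ?S' * ?G'"
    using nn_integral_norm_derivative_sq_le[OF \<phi>(1,2) \<phi>(3), of a 2 0]
      nn_integral_norm_derivative_sq_le[OF \<psi>(1,2) \<psi>(3), of b 2 0] ab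
    unfolding J_def J'_def by simp_all
  \<comment> \<open>The L1 inequality for the squared norm is upgraded to the L2 Poincare
    inequality: \<open>J\<close> is bounded by the root of \<open>4 * ?S * ?G\<close>, so after
    squaring one factor \<open>?S\<close> cancels.\<close>
  have "(\<integral>\<^sup>+x. ennreal \<bar>(norm (\<phi> x))\<^sup>2\<bar> \<partial>lborel) \<le> ennreal (2 * R) * J"
    unfolding J_def by (rule Poincare_slices[OF B C1_compact_norm_sq[OF \<phi>(1)] R(1)]) (simp add: R(2))
  then have "?S \<le> ennreal (2 * R) * J"
    by simp
  then have "?S\<^sup>2 \<le> (ennreal (2 * R) * J)\<^sup>2"
    by (intro power_mono) auto
  also have "\<dots> \<le> ennreal ((2 * R)\<^sup>2) * (4 * ?S * ?G)"
    using R(1) J(1) by (simp add: power_mult_distrib ennreal_power mult_left_mono)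
  finally have "?S * ?S \<le> ?S * (4 * ennreal ((2 * R)\<^sup>2) * ?G)"
    unfolding power2_eq_square[of ?S] by (simp add: mult_ac)
  moreover have "?S < top"
    using C1_compact_power_integrable[OF \<phi>(1), of 2] by simp
  ultimately have "?S \<le> 4 * ennreal ((2 * R)\<^sup>2) * ?G"
    by (rule ennreal_self_square_le)
  also have "4 * ennreal ((2 * R)\<^sup>2) = ennreal (16 * R\<^sup>2)"
    using ennreal_mult[of 4 "(2 * R)\<^sup>2"] by (simp add: power_mult_distrib)
  finally have S: "?S \<le> ennreal (16 * R\<^sup>2) * ?G" .
  have "(\<integral>\<^sup>+x. ennreal ((norm (\<phi> x) * norm (\<psi> x))\<^sup>2) \<partial>lborel) \<le> J * J'"
    using Ladyzhenskaya_slices[OF B C1_compact_norm_sq[OF \<phi>(1)] C1_compact_norm_sq[OF \<psi>(1)]]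
    unfolding J_def J'_def by (simp add: abs_mult power_mult_distrib)
  then have "(\<integral>\<^sup>+x. ennreal ((norm (\<phi> x) * norm (\<psi> x))\<^sup>2) \<partial>lborel)\<^sup>2 \<le> J\<^sup>2 * J'\<^sup>2"
    unfolding power_mult_distrib[symmetric] by (rule power_mono) simp
  also have "\<dots> \<le> (4 * (ennreal (16 * R\<^sup>2) * ?G) * ?G) * (4 * ?S' * ?G')"
    using J S by (intro mult_mono order_trans[OF J(1)]) auto
  also have "\<dots> = (16 * ennreal (16 * R\<^sup>2)) * ?G\<^sup>2 * ?S' * ?G'"
    by (rule reassoc)
  also have "16 * ennreal (16 * R\<^sup>2) = ennreal (256 * R\<^sup>2)"
    using ennreal_mult[of 16 "16 * R\<^sup>2"] by simp
  finally show ?thesis .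
qed

lemma interpolation_dim_2_3:
  fixes \<phi> :: "'a::euclidean_space \<Rightarrow> 'b::real_inner" and \<psi> :: "'a \<Rightarrow> 'b"
  assumes dim: "DIM('a) = 2 \<or> DIM('a) = 3"
    and \<phi>: "C1_compact \<phi> D" "N \<in> borel_measurable borel" "\<And>x b. b \<in> Basis \<Longrightarrow> norm (D x b) \<le> N x"
    and \<psi>: "C1_compact \<psi> E" "N' \<in> borel_measurable borel" "\<And>x b. b \<in> Basis \<Longrightarrow> norm (E x b) \<le> N' x"
    and R: "R \<ge> 0" "\<And>x. norm x > R \<Longrightarrow> \<phi> x = 0"
  shows "(\<integral>\<^sup>+x. ennreal ((norm (\<phi> x) * norm (\<psi> x))\<^sup>2) \<partial>lborel)\<^sup>2 \<le>
    ennreal (4096 + 256 * R\<^sup>2) * (\<integral>\<^sup>+x. ennreal ((N x)\<^sup>2) \<partial>lborel)\<^sup>2 *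
      (\<integral>\<^sup>+x. ennreal ((norm (\<psi> x))\<^sup>2) \<partial>lborel) * (\<integral>\<^sup>+x. ennreal ((N' x)\<^sup>2) \<partial>lborel)"
    (is "?I \<le> _ * ?A * ?B * ?C")
proof -
  have mono: "ennreal c * ?A * ?B * ?C \<le> ennreal (4096 + 256 * R\<^sup>2) * ?A * ?B * ?C"
    if "c \<le> 4096 + 256 * R\<^sup>2" for c
    using that by (intro mult_right_mono ennreal_leI) auto
  from dim show ?thesis
  proof
    assume "DIM('a) = 2"
    then have "?I \<le> ennreal (256 * R\<^sup>2) * ?A * ?B * ?C"
      using interpolation_dim_2[OF _ \<phi> \<psi> R] by blast
    also have "\<dots> \<le> ennreal (4096 + 256 * R\<^sup>2) * ?A * ?B * ?C"
      by (rule mono) simp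
    finally show ?thesis .
  next
    assume "DIM('a) = 3"
    then have "?I \<le> ennreal 4096 * ?A * ?B * ?C"
      using interpolation_dim_3[OF _ \<phi> \<psi>] by simp
    also have "\<dots> \<le> ennreal (4096 + 256 * R\<^sup>2) * ?A * ?B * ?C"
      by (rule mono) simp
    finally show ?thesis .
  qed
qed

section \<open>Vanishing of the integral of a directional derivative\<close>

lemma C1_compact_derivative_eq_0:
  assumes g: "C1_compact g D" and K: "compact K" "\<And>x. x \<notin> K \<Longrightarrow> g x = 0" and x: "x \<notin> K"
  shows "D x = (\<lambda>h. 0)"
proof -
  have "(g has_derivative (\<lambda>h. 0)) (at x)"
  proof (rule has_derivative_transform_within_open[where f = "\<lambda>x. 0" and s = "- K"])
    show "open (- K)"
      using K(1) by (simp add: open_Compl compact_imp_closed)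
  qed (use K x in auto)
  then show ?thesis
    using g has_derivative_unique unfolding C1_compact_def by blast
qed

text \<open>By translation invariance of Lebesgue measure every difference quotient of
  \<open>g\<close> has integral 0. Dominated convergence carries this to the derivative, in any
  dimension and for any direction.\<close>

lemma C1_compact_integral_derivative:
  fixes g :: "'a::euclidean_space \<Rightarrow> real"
  assumes g: "C1_compact g D"
  shows "integrable lborel (\<lambda>x. D x b)" "(\<integral>x. D x b \<partial>lborel) = 0"
proof -
  obtain K where K: "compact K" "\<And>x. x \<notin> K \<Longrightarrow> g x = 0"
    using g unfolding C1_compact_def by auto
  have D0: "D x b = 0" if "x \<notin> K" for x
    using C1_compact_derivative_eq_0[OF g K that] by simp
  have Dc: "continuous_on UNIV (\<lambda>x. D x b)" and Dg: "\<And>x. (g has_derivative D x) (at x)"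
    using g unfolding C1_compact_def by auto
  note [measurable] = C1_compact_borel[OF g]
  have gi: "integrable lborel g"
    using C1_compact_power_integrable[OF g, of 1] by (simp add: integrable_iff_bounded)
  have "bounded ((\<lambda>x. D x b) ` K)"
    using K(1) Dc by (intro compact_imp_bounded compact_continuous_image) (auto intro: continuous_on_subset)
  then obtain M where M: "\<And>x. x \<in> K \<Longrightarrow> \<bar>D x b\<bar> \<le> M" "M \<ge> 0"
    by (force simp: bounded_pos)
  have DM: "\<bar>D x b\<bar> \<le> M" for x
    using M D0[of x] by (cases "x \<in> K") auto
  obtain R where R: "\<And>x. x \<in> K \<Longrightarrow> norm x \<le> R"
    using compact_imp_bounded[OF K(1)] by (auto simp: bounded_iff)
  define r where "r n = 1 / real (Suc n)" for n
  have r: "r n > 0" "r n \<le> 1" for n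
    by (auto simp: r_def)
  define q where "q n x = (g (x + r n *\<^sub>R b) - g x) / r n" for n x
  \<comment> \<open>The dominating function: the mean value theorem bounds a quotient by
    \<open>M\<close>, and since \<open>r n\<close> is at most 1 the shift moves the support by at
    most \<open>norm b\<close>.\<close>
  define w where "w x = M * indicator (cball 0 (R + norm b)) x" for x :: 'a
  have wi: "integrable lborel w"
    unfolding w_def by (intro integrable_mult_right integrable_real_indicator)
      (use emeasure_bounded_finite[of "cball 0 (R + norm b)"] in auto)
  note line = C1_compact_line_derivative[OF g, where b = b]
  have qw: "norm (q n x) \<le> w x" for n x
  proof (cases "norm x \<le> R + norm b")
    case True
    obtain s where "g (x + r n *\<^sub>R b) - g (x + 0 *\<^sub>R b) = (r n - 0) * D (x + s *\<^sub>R b) b"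
      using MVT2[OF r(1)[of n], where f = "\<lambda>s. g (x + s *\<^sub>R b)" and f' = "\<lambda>s. D (x + s *\<^sub>R b) b"] line by blast
    then have "q n x = D (x + s *\<^sub>R b) b"
      using r(1)[of n] by (simp add: q_def)
    then show ?thesis
      using DM True by (simp add: w_def)
  next
    case False
    have "norm (r n *\<^sub>R b) \<le> norm b"
      using r[of n] by (simp add: mult_left_le_one_le)
    then have "norm (x + r n *\<^sub>R b) > R"
      using norm_diff_ineq[of x "r n *\<^sub>R b"] False by linarith
    moreover have "norm x > R"
      using False norm_ge_zero[of b] by linarith
    ultimately have "g (x + r n *\<^sub>R b) = 0" "g x = 0"
      using R K(2) not_le by blast+
    then show ?thesis
      using M(2) by (simp add: q_def w_def)
  qed
  have qlim: "(\<lambda>n. q n x) \<longlonglongrightarrow> D x b" for x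
  proof -
    have "((\<lambda>s. (g (x + s *\<^sub>R b) - g x) / s) \<longlongrightarrow> D x b) (at 0)"
      using line[of x 0] by (simp add: has_field_derivative_iff)
    moreover have "filterlim r (at 0) sequentially"
      unfolding filterlim_at using LIMSEQ_inverse_real_of_nat r(1)
      by (auto simp: r_def[abs_def] inverse_eq_divide less_imp_neq[symmetric] intro!: always_eventually)
    ultimately show ?thesis
      unfolding q_def by (rule filterlim_compose)
  qed
  have qm: "q n \<in> borel_measurable lborel" for n
    unfolding q_def by measurable
  show "integrable lborel (\<lambda>x. D x b)"
    by (rule integrable_dominated_convergence[where s = q and w = w])
      (use qm qlim qw wi in auto)
  have "(\<lambda>n. \<integral>x. q n x \<partial>lborel) \<longlonglongrightarrow> (\<integral>x. D x b \<partial>lborel)"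
    by (rule integral_dominated_convergence[where w = w])
      (use qm qlim qw wi in auto)
  moreover have "(\<integral>x. q n x \<partial>lborel) = 0" for n
  proof -
    have shift: "distr lborel borel (\<lambda>x. r n *\<^sub>R b + x) = lborel"
      by (simp add: lborel_distr_plus)
    have i: "integrable lborel (\<lambda>x. g (r n *\<^sub>R b + x))"
      using gi integrable_distr_eq[of "\<lambda>x. r n *\<^sub>R b + x" lborel borel g] shift by simp
    have "(\<integral>x. g (r n *\<^sub>R b + x) \<partial>lborel) = (\<integral>x. g x \<partial>lborel)"
      using integral_distr[of "\<lambda>x. r n *\<^sub>R b + x" lborel borel g] shift by simp
    then show ?thesis
      using gi i by (simp add: q_def add.commute)
  qed
  ultimately show "(\<integral>x. D x b \<partial>lborel) = 0"
    by (simp add: LIMSEQ_const_iff)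
qed

section \<open>Square integrable functions\<close>

lemma L2_iff_nn_integral:
  fixes u :: "'a::euclidean_space \<Rightarrow> 'b::real_normed_vector"
  shows "L2 \<Omega> u \<longleftrightarrow> u \<in> borel_measurable (lebesgue_on \<Omega>) \<and>
    (\<integral>\<^sup>+x. ennreal ((norm (u x))\<^sup>2) \<partial>lebesgue_on \<Omega>) < top"
  unfolding L2_def by (auto simp: integrable_iff_bounded)

lemma L2_measurable: "L2 \<Omega> u \<Longrightarrow> u \<in> borel_measurable (lebesgue_on \<Omega>)"
  and L2_integrable_sq: "L2 \<Omega> u \<Longrightarrow> integrable (lebesgue_on \<Omega>) (\<lambda>x. (norm (u x))\<^sup>2)"
  unfolding L2_def by auto

lemma L2norm_nonneg: "L2norm \<Omega> u \<ge> 0"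
  unfolding L2norm_def L2ip_def by (simp add: integral_nonneg_AE)

lemma L2norm_sq: "(L2norm \<Omega> u)\<^sup>2 = (\<integral>x. (norm (u x))\<^sup>2 \<partial>lebesgue_on \<Omega>)"
  unfolding L2norm_def L2ip_def by (simp add: power2_norm_eq_inner integral_nonneg_AE)

lemma ennreal_L2norm_sq:
  "L2 \<Omega> u \<Longrightarrow> ennreal ((L2norm \<Omega> u)\<^sup>2) = (\<integral>\<^sup>+x. ennreal ((norm (u x))\<^sup>2) \<partial>lebesgue_on \<Omega>)"
  unfolding L2norm_sq by (intro nn_integral_eq_integral[symmetric] L2_integrable_sq) auto

lemma L2_scaleR:
  assumes "L2 \<Omega> u"
  shows "L2 \<Omega> (\<lambda>x. c *\<^sub>R u x)"
  using assms unfolding L2_def by (auto simp: power_mult_distrib)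

lemma L2_norm_mult_integrable:
  fixes u :: "'a::euclidean_space \<Rightarrow> 'b::euclidean_space" and v :: "'a \<Rightarrow> 'c::euclidean_space"
  assumes u: "L2 \<Omega> u" and v: "L2 \<Omega> v"
  shows "integrable (lebesgue_on \<Omega>) (\<lambda>x. norm (u x) * norm (v x))"
proof (rule Bochner_Integration.integrable_bound)
  show "integrable (lebesgue_on \<Omega>) (\<lambda>x. (norm (u x))\<^sup>2 + (norm (v x))\<^sup>2)"
    using u v by (intro Bochner_Integration.integrable_add L2_integrable_sq)
  show "(\<lambda>x. norm (u x) * norm (v x)) \<in> borel_measurable (lebesgue_on \<Omega>)"
    using L2_measurable[OF u] L2_measurable[OF v] by measurable
  have "p * q \<le> p\<^sup>2 + q\<^sup>2" if "p \<ge> 0" "q \<ge> 0" for p q :: real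
    using sum_squares_bound[of p q] mult_nonneg_nonneg[OF that] by linarith
  then show "AE x in lebesgue_on \<Omega>. norm (norm (u x) * norm (v x)) \<le> norm ((norm (u x))\<^sup>2 + (norm (v x))\<^sup>2)"
    by simp
qed

lemma L2_Cauchy_Schwarz_norm:
  fixes u :: "'a::euclidean_space \<Rightarrow> 'b::euclidean_space" and v :: "'a \<Rightarrow> 'c::euclidean_space"
  assumes u: "L2 \<Omega> u" and v: "L2 \<Omega> v"
  shows "(\<integral>x. norm (u x) * norm (v x) \<partial>lebesgue_on \<Omega>) \<le> L2norm \<Omega> u * L2norm \<Omega> v"
proof -
  let ?I = "\<integral>x. norm (u x) * norm (v x) \<partial>lebesgue_on \<Omega>"
  have "ennreal (?I\<^sup>2) = (\<integral>\<^sup>+x. ennreal (norm (u x) * norm (v x)) \<partial>lebesgue_on \<Omega>)\<^sup>2"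
    using nn_integral_eq_integral[OF L2_norm_mult_integrable[OF u v]]
    by (simp add: ennreal_power integral_nonneg_AE)
  also have "\<dots> \<le> ennreal ((L2norm \<Omega> u)\<^sup>2) * ennreal ((L2norm \<Omega> v)\<^sup>2)"
    unfolding ennreal_L2norm_sq[OF u] ennreal_L2norm_sq[OF v]
    using L2_measurable[OF u] L2_measurable[OF v]
    by (intro nn_integral_Cauchy_Schwarz_real) (auto simp: power_mult_distrib)
  also have "\<dots> = ennreal ((L2norm \<Omega> u * L2norm \<Omega> v)\<^sup>2)"
    by (simp add: power_mult_distrib ennreal_mult)
  finally have "?I\<^sup>2 \<le> (L2norm \<Omega> u * L2norm \<Omega> v)\<^sup>2"
    by (simp add: ennreal_le_iff)
  then show ?thesis
    by (rule power2_le_imp_le) (simp add: L2norm_nonneg)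
qed

lemma L2_inner_integrable:
  fixes u v :: "'a::euclidean_space \<Rightarrow> 'b::euclidean_space"
  assumes u: "L2 \<Omega> u" and v: "L2 \<Omega> v"
  shows "integrable (lebesgue_on \<Omega>) (\<lambda>x. u x \<bullet> v x)"
  using L2_measurable[OF u] L2_measurable[OF v]
  by (intro Bochner_Integration.integrable_bound[OF L2_norm_mult_integrable[OF u v]]) (auto simp: Cauchy_Schwarz_ineq2)

lemma L2_add:
  fixes u v :: "'a::euclidean_space \<Rightarrow> 'b::euclidean_space"
  assumes u: "L2 \<Omega> u" and v: "L2 \<Omega> v"
  shows "L2 \<Omega> (\<lambda>x. u x + v x)"
  unfolding L2_def
proof
  show "(\<lambda>x. u x + v x) \<in> borel_measurable (lebesgue_on \<Omega>)"
    using L2_measurable[OF u] L2_measurable[OF v] by measurable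
  have "(norm (u x + v x))\<^sup>2 = (norm (u x))\<^sup>2 + 2 * (u x \<bullet> v x) + (norm (v x))\<^sup>2" for x
    by (simp add: power2_norm_eq_inner inner_add_left inner_add_right inner_commute)
  then show "integrable (lebesgue_on \<Omega>) (\<lambda>x. (norm (u x + v x))\<^sup>2)"
    using L2_integrable_sq[OF u] L2_integrable_sq[OF v] L2_inner_integrable[OF u v] by simp
qed

lemma L2_diff:
  fixes u v :: "'a::euclidean_space \<Rightarrow> 'b::euclidean_space"
  assumes "L2 \<Omega> u" "L2 \<Omega> v"
  shows "L2 \<Omega> (\<lambda>x. u x - v x)"
  using L2_add[OF assms(1) L2_scaleR[OF assms(2), of "-1"]] by simp

lemma L2norm_triangle:
  fixes u v :: "'a::euclidean_space \<Rightarrow> 'b::euclidean_space"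
  assumes u: "L2 \<Omega> u" and v: "L2 \<Omega> v"
  shows "L2norm \<Omega> (\<lambda>x. u x + v x) \<le> L2norm \<Omega> u + L2norm \<Omega> v"
proof (rule power2_le_imp_le)
  have "(L2norm \<Omega> (\<lambda>x. u x + v x))\<^sup>2 \<le>
      (\<integral>x. (norm (u x))\<^sup>2 + 2 * (norm (u x) * norm (v x)) + (norm (v x))\<^sup>2 \<partial>lebesgue_on \<Omega>)"
    unfolding L2norm_sq
  proof (rule integral_mono)
    show "(norm (u x + v x))\<^sup>2 \<le> (norm (u x))\<^sup>2 + 2 * (norm (u x) * norm (v x)) + (norm (v x))\<^sup>2" for x
      using power_mono[OF norm_triangle_ineq[of "u x" "v x"], of 2] by (simp add: power2_sum)
  qed (auto intro!: Bochner_Integration.integrable_add integrable_mult_right L2_integrable_sq L2_add L2_norm_mult_integrable u v)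
  also have "\<dots> = (L2norm \<Omega> u)\<^sup>2 + 2 * (\<integral>x. norm (u x) * norm (v x) \<partial>lebesgue_on \<Omega>) + (L2norm \<Omega> v)\<^sup>2"
    unfolding L2norm_sq by (simp add: L2_integrable_sq L2_norm_mult_integrable u v)
  also have "\<dots> \<le> (L2norm \<Omega> u + L2norm \<Omega> v)\<^sup>2"
    using L2_Cauchy_Schwarz_norm[OF u v] by (simp add: power2_sum)
  finally show "(L2norm \<Omega> (\<lambda>x. u x + v x))\<^sup>2 \<le> (L2norm \<Omega> u + L2norm \<Omega> v)\<^sup>2" .
qed (simp add: L2norm_nonneg)

lemma L2norm_scaleR: "L2norm \<Omega> (\<lambda>x. c *\<^sub>R u x) = \<bar>c\<bar> * L2norm \<Omega> u"
proof -
  have "(L2norm \<Omega> (\<lambda>x. c *\<^sub>R u x))\<^sup>2 = (\<bar>c\<bar> * L2norm \<Omega> u)\<^sup>2"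
    unfolding power_mult_distrib L2norm_sq by (simp add: power_mult_distrib)
  then show ?thesis
    by (rule power2_eq_imp_eq) (auto simp: L2norm_nonneg)
qed

lemma L2norm_minus_commute: "L2norm \<Omega> (\<lambda>x. u x - v x) = L2norm \<Omega> (\<lambda>x. v x - u x)"
  using L2norm_scaleR[of \<Omega> "-1" "\<lambda>x. v x - u x"] by simp

lemma tendsto_L2norm:
  fixes u :: "'a::euclidean_space \<Rightarrow> 'b::euclidean_space"
  assumes u: "L2 \<Omega> u" and v: "\<And>k. L2 \<Omega> (v k)"
    and lim: "(\<lambda>k. L2norm \<Omega> (\<lambda>x. v k x - u x)) \<longlonglongrightarrow> 0"
  shows "(\<lambda>k. L2norm \<Omega> (v k)) \<longlonglongrightarrow> L2norm \<Omega> u"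
proof (rule LIM_zero_cancel, rule Lim_null_comparison[OF always_eventually lim], rule allI)
  fix k
  have "L2norm \<Omega> (v k) \<le> L2norm \<Omega> (\<lambda>x. v k x - u x) + L2norm \<Omega> u"
    using L2norm_triangle[OF L2_diff[OF v[of k] u] u] by simp
  moreover have "L2norm \<Omega> u \<le> L2norm \<Omega> (\<lambda>x. u x - v k x) + L2norm \<Omega> (v k)"
    using L2norm_triangle[OF L2_diff[OF u v[of k]] v[of k]] by simp
  ultimately show "norm (L2norm \<Omega> (v k) - L2norm \<Omega> u) \<le> L2norm \<Omega> (\<lambda>x. v k x - u x)"
    using L2norm_minus_commute[of \<Omega> u "v k"] by simp
qed

text \<open>The squared distance tends to 0 in L1, so the almost everywhere subsequence theorem for
  L1 applies to it.\<close>

lemma L2_AE_subseq: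
  fixes u :: "'a::euclidean_space \<Rightarrow> 'b::euclidean_space"
  assumes u: "L2 \<Omega> u" and v: "\<And>k. L2 \<Omega> (v k)"
    and lim: "(\<lambda>k. L2norm \<Omega> (\<lambda>x. v k x - u x)) \<longlonglongrightarrow> 0"
  obtains r where "strict_mono r" "AE x in lebesgue_on \<Omega>. (\<lambda>k. v (r k) x) \<longlonglongrightarrow> u x"
proof -
  have "(\<lambda>k. (L2norm \<Omega> (\<lambda>x. v k x - u x))\<^sup>2) \<longlonglongrightarrow> 0\<^sup>2"
    by (intro tendsto_power lim)
  then have "(\<lambda>k. \<integral>x. norm ((norm (v k x - u x))\<^sup>2) \<partial>lebesgue_on \<Omega>) \<longlonglongrightarrow> 0"
    unfolding L2norm_sq by simp
  from tendsto_L1_AE_subseq[OF _ this] obtain r where r: "strict_mono r"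
      and ae: "AE x in lebesgue_on \<Omega>. (\<lambda>k. (norm (v (r k) x - u x))\<^sup>2) \<longlonglongrightarrow> 0"
    using L2_integrable_sq[OF L2_diff[OF v u]] by blast
  have conv: "(\<lambda>k. v (r k) x) \<longlonglongrightarrow> u x" if "(\<lambda>k. (norm (v (r k) x - u x))\<^sup>2) \<longlonglongrightarrow> 0" for x
    using tendsto_real_sqrt[OF that] by (simp add: LIM_zero_iff tendsto_norm_zero_iff)
  show thesis
    by (rule that[OF r]) (rule eventually_mono[OF ae conv])
qed

section \<open>From integrals over the domain to integrals over the whole space\<close>

lemma borel_measurable_lebesgue_on:
  "f \<in> borel_measurable borel \<Longrightarrow> f \<in> borel_measurable (lebesgue_on \<Omega>)"
  by (intro measurable_restrict_space1 measurable_completion) simp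

lemma nn_integral_lebesgue_on_support:
  assumes "\<Omega> \<in> sets lebesgue" "\<And>x. x \<notin> \<Omega> \<Longrightarrow> f x = 0"
  shows "(\<integral>\<^sup>+x. f x \<partial>lebesgue_on \<Omega>) = (\<integral>\<^sup>+x. f x \<partial>lborel)"
proof -
  have "(\<integral>\<^sup>+x. f x \<partial>lebesgue_on \<Omega>) = (\<integral>\<^sup>+x. f x * indicator \<Omega> x \<partial>lebesgue)"
    using assms(1) by (simp add: nn_integral_restrict_space)
  also have "\<dots> = (\<integral>\<^sup>+x. f x \<partial>lebesgue)"
    using assms(2) by (intro nn_integral_cong) (auto simp: indicator_def)
  finally show ?thesis
    by (simp add: nn_integral_completion)
qed

lemma integral_lebesgue_on_support:
  fixes f :: "'a::euclidean_space \<Rightarrow> real"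
  assumes "\<Omega> \<in> sets lebesgue" "\<And>x. x \<notin> \<Omega> \<Longrightarrow> f x = 0" "f \<in> borel_measurable borel"
  shows "(\<integral>x. f x \<partial>lebesgue_on \<Omega>) = (\<integral>x. f x \<partial>lborel)"
proof -
  have "(\<integral>x. f x \<partial>lebesgue_on \<Omega>) = (\<integral>x. indicator \<Omega> x *\<^sub>R f x \<partial>lebesgue)"
    using assms(1) by (simp add: integral_restrict_space)
  also have "\<dots> = (\<integral>x. f x \<partial>lebesgue)"
    using assms(2) by (intro Bochner_Integration.integral_cong) (auto simp: indicator_def)
  finally show ?thesis
    using assms(3) by (simp add: integral_completion)
qed

lemma L2_continuous_compact_support:
  fixes f :: "'a::euclidean_space \<Rightarrow> 'b::euclidean_space"
  assumes \<Omega>: "\<Omega> \<in> sets lebesgue" and f: "continuous_on UNIV f"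
    and K: "compact K" "K \<subseteq> \<Omega>" "\<And>x. x \<notin> K \<Longrightarrow> f x = 0"
  shows "L2 \<Omega> f"
  unfolding L2_iff_nn_integral
proof
  show "f \<in> borel_measurable (lebesgue_on \<Omega>)"
    using f by (intro borel_measurable_lebesgue_on borel_measurable_continuous_onI)
  have "integrable lborel (\<lambda>x. indicator K x *\<^sub>R (norm (f x))\<^sup>2)"
    using K(1) continuous_on_subset[OF f] by (intro borel_integrable_compact continuous_intros) auto
  moreover have "(\<lambda>x. indicator K x *\<^sub>R (norm (f x))\<^sup>2) = (\<lambda>x. (norm (f x))\<^sup>2)"
    using K(3) by (fastforce simp: indicator_def)
  ultimately have "integrable lborel (\<lambda>x. (norm (f x))\<^sup>2)"
    by (simp only:)
  moreover have "(\<integral>\<^sup>+x. ennreal ((norm (f x))\<^sup>2) \<partial>lebesgue_on \<Omega>) = (\<integral>\<^sup>+x. ennreal ((norm (f x))\<^sup>2) \<partial>lborel)"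
    by (rule nn_integral_lebesgue_on_support[OF \<Omega>]) (use K in auto)
  ultimately show "(\<integral>\<^sup>+x. ennreal ((norm (f x))\<^sup>2) \<partial>lebesgue_on \<Omega>) < top"
    by (simp add: integrable_iff_bounded)
qed

section \<open>The closure of the smooth fields\<close>

lemma norm_matrix_vector_mult_le:
  fixes A :: "real^'n^'m"
  shows "norm (A *v x) \<le> norm A * norm x"
proof -
  have "norm (A *v x) = L2_set (\<lambda>i. \<bar>(A $ i) \<bullet> x\<bar>) UNIV"
    by (simp add: norm_vec_def matrix_mult_dot L2_set_def)
  also have "\<dots> \<le> L2_set (\<lambda>i. norm (A $ i) * norm x) UNIV"
    by (rule L2_set_mono) (auto simp: Cauchy_Schwarz_ineq2)
  also have "\<dots> = norm A * norm x"
    by (simp add: L2_set_left_distrib norm_vec_def)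
  finally show ?thesis .
qed

lemma bounded_bilinear_matrix_vector_mult:
  "bounded_bilinear ((*v) :: real^'n^'m \<Rightarrow> real^'n \<Rightarrow> real^'m)"
proof
  show "\<exists>K. \<forall>(A :: real^'n^'m) x. norm (A *v x) \<le> norm A * norm x * K"
    using norm_matrix_vector_mult_le by (metis mult.right_neutral)
qed (simp_all add: matrix_vector_mult_add_rdistrib matrix_vector_right_distrib
    matrix_vector_mult_scaleR scaleR_matrix_vector_assoc)

lemma abs_trace_le:
  fixes A :: "real^'n^'n"
  shows "\<bar>trace A\<bar> \<le> real CARD('n) * norm A"
proof -
  have "\<bar>A $ i $ i\<bar> \<le> norm A" for i
    using component_le_norm_cart[of "A $ i" i] Finite_Cartesian_Product.norm_nth_le[of A i] by linarith
  then have "(\<Sum>i\<in>UNIV. \<bar>A $ i $ i\<bar>) \<le> (\<Sum>i\<in>(UNIV::'n set). norm A)"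
    by (intro sum_mono)
  then show ?thesis
    unfolding trace_def using order_trans[OF sum_abs[of "\<lambda>i. A $ i $ i" UNIV]] by simp
qed

lemma grad_C1_eq:
  assumes "(\<phi> has_derivative (*v) A) (at x)"
  shows "grad_C1 \<phi> x = A"
  unfolding grad_C1_def frechet_derivative_at[OF assms, symmetric] by simp

lemma grad_C1_has_derivative:
  assumes "\<phi> differentiable (at x)"
  shows "(\<phi> has_derivative (*v) (grad_C1 \<phi> x)) (at x)"
proof -
  have d: "(\<phi> has_derivative frechet_derivative \<phi> (at x)) (at x)"
    using assms by (simp add: frechet_derivative_works)
  have "(*v) (grad_C1 \<phi> x) = frechet_derivative \<phi> (at x)"
    unfolding grad_C1_def using matrix_works[OF has_derivative_linear[OF d, unfolded linear_matrix_vector_mul_eq[symmetric]]]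
    by auto
  with d show ?thesis
    by simp
qed

lemma C1c_C1_compact:
  assumes "C1c \<Omega> \<phi>"
  shows "C1_compact \<phi> (\<lambda>x h. grad_C1 \<phi> x *v h)"
proof -
  have "continuous_on UNIV (\<lambda>x. grad_C1 \<phi> x *v h)" for h
    using assms unfolding C1c_def
    by (intro bounded_linear.continuous_on[OF bounded_bilinear.bounded_linear_left[OF bounded_bilinear_matrix_vector_mult]]) auto
  then show ?thesis
    using assms grad_C1_has_derivative unfolding C1c_def C1_compact_def by blast
qed


lemma C1c_gradient_eq_0:
  assumes "C1c \<Omega> \<phi>" "compact K" "\<And>x. x \<notin> K \<Longrightarrow> \<phi> x = 0" "x \<notin> K"
  shows "grad_C1 \<phi> x = 0"
proof -
  have "grad_C1 \<phi> x *v h = 0 *v h" for h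
    using fun_cong[OF C1_compact_derivative_eq_0[OF C1c_C1_compact[OF assms(1)] assms(2-4)], of h] by simp
  then show ?thesis
    by (simp add: matrix_eq)
qed

lemma C1c_zero_outside:
  assumes "C1c \<Omega> \<phi>" "x \<notin> \<Omega>"
  shows "\<phi> x = 0" "grad_C1 \<phi> x = 0"
  using C1c_gradient_eq_0[OF assms(1)] assms unfolding C1c_def by blast+

lemma C1c_L2:
  assumes \<Omega>: "\<Omega> \<in> sets lebesgue" and \<phi>: "C1c \<Omega> \<phi>"
  shows "L2 \<Omega> \<phi>" "L2 \<Omega> (grad_C1 \<phi>)"
proof -
  obtain K where K: "compact K" "K \<subseteq> \<Omega>" "\<And>x. x \<notin> K \<Longrightarrow> \<phi> x = 0"
    using \<phi> unfolding C1c_def by blast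
  show "L2 \<Omega> \<phi>"
    by (rule L2_continuous_compact_support[OF \<Omega> C1_compact_continuous[OF C1c_C1_compact[OF \<phi>]] K])
  show "L2 \<Omega> (grad_C1 \<phi>)"
    by (rule L2_continuous_compact_support[OF \<Omega> _ K(1,2) C1c_gradient_eq_0[OF \<phi> K(1,3)]])
      (use \<phi> in \<open>auto simp: C1c_def\<close>)
qed

text \<open>Smooth fields vanish outside the domain, so the whole-space inequality applies. The norm
  of the gradient matrix bounds every directional derivative along a basis vector, and comparing
  squares gives the unsquared form.\<close>

lemma C1c_interpolation:
  fixes \<Omega> :: "(real^'n) set"
  assumes dim: "CARD('n) = 2 \<or> CARD('n) = 3" and \<Omega>: "\<Omega> \<in> sets lebesgue" "\<Omega> \<subseteq> cball 0 R" "R \<ge> 0"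
    and \<phi>: "C1c \<Omega> \<phi>" and \<psi>: "C1c \<Omega> \<psi>"
  shows "(\<integral>\<^sup>+x. ennreal ((norm (\<phi> x) * norm (\<psi> x))\<^sup>2) \<partial>lebesgue_on \<Omega>) \<le>
    ennreal (sqrt (4096 + 256 * R\<^sup>2) * (L2norm \<Omega> (grad_C1 \<phi>))\<^sup>2 * L2norm \<Omega> \<psi> * L2norm \<Omega> (grad_C1 \<psi>))"
proof (rule power2_le_imp_le_ennreal)
  have collect: "ennreal K * (ennreal (p\<^sup>2))\<^sup>2 * ennreal (q\<^sup>2) * ennreal (s\<^sup>2) =
      (ennreal (sqrt K * p\<^sup>2 * q * s))\<^sup>2" if "K \<ge> 0" "p \<ge> 0" "q \<ge> 0" "s \<ge> 0" for K p q s :: real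
    using that by (simp add: ennreal_power power_mult_distrib flip: ennreal_mult)
  have sq: "(\<integral>\<^sup>+x. ennreal ((norm (f x))\<^sup>2) \<partial>lborel) = ennreal ((L2norm \<Omega> f)\<^sup>2)"
    if "L2 \<Omega> f" "\<And>x. x \<notin> \<Omega> \<Longrightarrow> f x = 0" for f :: "real^'n \<Rightarrow> 'z::euclidean_space"
    unfolding ennreal_L2norm_sq[OF that(1)]
    by (rule nn_integral_lebesgue_on_support[OF \<Omega>(1), symmetric]) (simp add: that(2))
  have le: "norm (grad_C1 \<eta> x *v b) \<le> norm (grad_C1 \<eta> x)" if "b \<in> Basis" for \<eta> :: "real^'n \<Rightarrow> real^'n" and x b
    using norm_matrix_vector_mult_le[of "grad_C1 \<eta> x" b] that by simp
  have meas: "(\<lambda>x. norm (grad_C1 \<eta> x)) \<in> borel_measurable borel" if "C1c \<Omega> \<eta>" for \<eta>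
    using that unfolding C1c_def by (intro borel_measurable_continuous_onI continuous_intros) auto
  have "\<phi> x = 0" if "norm x > R" for x
  proof -
    have "x \<notin> cball 0 R"
      using that by simp
    then show ?thesis
      using C1c_zero_outside(1)[OF \<phi>] \<Omega>(2) by blast
  qed
  then have "(\<integral>\<^sup>+x. ennreal ((norm (\<phi> x) * norm (\<psi> x))\<^sup>2) \<partial>lborel)\<^sup>2 \<le>
    ennreal (4096 + 256 * R\<^sup>2) * (\<integral>\<^sup>+x. ennreal ((norm (grad_C1 \<phi> x))\<^sup>2) \<partial>lborel)\<^sup>2 *
      (\<integral>\<^sup>+x. ennreal ((norm (\<psi> x))\<^sup>2) \<partial>lborel) * (\<integral>\<^sup>+x. ennreal ((norm (grad_C1 \<psi> x))\<^sup>2) \<partial>lborel)"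
    using dim \<Omega>(3)
    by (intro interpolation_dim_2_3[OF _ C1c_C1_compact[OF \<phi>] meas[OF \<phi>] le C1c_C1_compact[OF \<psi>] meas[OF \<psi>] le])
      auto
  also have "\<dots> = ennreal (4096 + 256 * R\<^sup>2) * (ennreal ((L2norm \<Omega> (grad_C1 \<phi>))\<^sup>2))\<^sup>2 *
      ennreal ((L2norm \<Omega> \<psi>)\<^sup>2) * ennreal ((L2norm \<Omega> (grad_C1 \<psi>))\<^sup>2)"
    using C1c_L2[OF \<Omega>(1) \<phi>] C1c_L2[OF \<Omega>(1) \<psi>] C1c_zero_outside[OF \<phi>] C1c_zero_outside[OF \<psi>]
    by (simp add: sq)
  also have "\<dots> = (ennreal (sqrt (4096 + 256 * R\<^sup>2) * (L2norm \<Omega> (grad_C1 \<phi>))\<^sup>2 * L2norm \<Omega> \<psi> *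
      L2norm \<Omega> (grad_C1 \<psi>)))\<^sup>2"
    by (rule collect) (simp_all add: L2norm_nonneg)
  also have "(\<integral>\<^sup>+x. ennreal ((norm (\<phi> x) * norm (\<psi> x))\<^sup>2) \<partial>lborel) =
      (\<integral>\<^sup>+x. ennreal ((norm (\<phi> x) * norm (\<psi> x))\<^sup>2) \<partial>lebesgue_on \<Omega>)"
    by (rule nn_integral_lebesgue_on_support[OF \<Omega>(1), symmetric]) (simp add: C1c_zero_outside[OF \<phi>])
  finally show "(\<integral>\<^sup>+x. ennreal ((norm (\<phi> x) * norm (\<psi> x))\<^sup>2) \<partial>lebesgue_on \<Omega>)\<^sup>2 \<le>
    (ennreal (sqrt (4096 + 256 * R\<^sup>2) * (L2norm \<Omega> (grad_C1 \<phi>))\<^sup>2 * L2norm \<Omega> \<psi> *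
      L2norm \<Omega> (grad_C1 \<psi>)))\<^sup>2" .
qed

lemma C1c_lincomb:
  assumes \<phi>: "C1c \<Omega> \<phi>" and \<psi>: "C1c \<Omega> \<psi>"
  shows "C1c \<Omega> (\<lambda>x. a *\<^sub>R \<phi> x + b *\<^sub>R \<psi> x)"
    and "grad_C1 (\<lambda>x. a *\<^sub>R \<phi> x + b *\<^sub>R \<psi> x) = (\<lambda>x. a *\<^sub>R grad_C1 \<phi> x + b *\<^sub>R grad_C1 \<psi> x)"
proof -
  let ?\<eta> = "\<lambda>x. a *\<^sub>R \<phi> x + b *\<^sub>R \<psi> x" and ?A = "\<lambda>x. a *\<^sub>R grad_C1 \<phi> x + b *\<^sub>R grad_C1 \<psi> x"
  have d: "(?\<eta> has_derivative (*v) (?A x)) (at x)" for x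
  proof -
    have "(\<phi> has_derivative (*v) (grad_C1 \<phi> x)) (at x)" "(\<psi> has_derivative (*v) (grad_C1 \<psi> x)) (at x)"
      using \<phi> \<psi> unfolding C1c_def by (auto intro: grad_C1_has_derivative)
    then have "(?\<eta> has_derivative (\<lambda>h. a *\<^sub>R (grad_C1 \<phi> x *v h) + b *\<^sub>R (grad_C1 \<psi> x *v h))) (at x)"
      by (intro has_derivative_add has_derivative_scaleR_right)
    moreover have "(\<lambda>h. a *\<^sub>R (grad_C1 \<phi> x *v h) + b *\<^sub>R (grad_C1 \<psi> x *v h)) = (*v) (?A x)"
      by (simp add: fun_eq_iff matrix_vector_mult_add_rdistrib scaleR_matrix_vector_assoc)
    ultimately show ?thesis
      by simp
  qed
  show g: "grad_C1 ?\<eta> = ?A"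
    using grad_C1_eq[OF d] by (simp add: fun_eq_iff)
  obtain K L where K: "compact K" "K \<subseteq> \<Omega>" "\<And>x. x \<notin> K \<Longrightarrow> \<phi> x = 0"
      and L: "compact L" "L \<subseteq> \<Omega>" "\<And>x. x \<notin> L \<Longrightarrow> \<psi> x = 0"
    using \<phi> \<psi> unfolding C1c_def by blast
  have "\<exists>K. compact K \<and> K \<subseteq> \<Omega> \<and> (\<forall>x. x \<notin> K \<longrightarrow> ?\<eta> x = 0)"
    using K L by (intro exI[of _ "K \<union> L"]) (auto intro: compact_Un)
  moreover have "continuous_on UNIV ?A"
    using \<phi> \<psi> unfolding C1c_def by (intro continuous_intros) auto
  ultimately show "C1c \<Omega> ?\<eta>"
    unfolding C1c_def g using d by (auto simp: differentiable_def)
qed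

section \<open>Fields together with gradients obtained as limits\<close>

lemma H10_rel_L2:
  assumes "H10_rel \<Omega> u G"
  shows "L2 \<Omega> u" "L2 \<Omega> G"
  using assms unfolding H10_rel_def by auto

lemma H10_rel_C1c:
  fixes \<Omega> :: "(real^'n) set"
  assumes "\<Omega> \<in> sets lebesgue" "C1c \<Omega> \<phi>"
  shows "H10_rel \<Omega> \<phi> (grad_C1 \<phi>)"
proof -
  have "L2norm \<Omega> (\<lambda>x. 0 :: real^'n) = 0" "L2norm \<Omega> (\<lambda>x. 0 :: real^'n^'n) = 0"
    by (simp_all add: L2norm_def L2ip_def)
  then show ?thesis
    unfolding H10_rel_def using C1c_L2[OF assms] assms(2) by (auto intro!: exI[of _ "\<lambda>_. \<phi>"])
qed

text \<open>Linearity holds for the relation, with the gradients carried along explicitly; nothing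
  is claimed about the gradient that \<open>wgrad\<close> selects for the combination.\<close>

lemma H10_rel_lincomb:
  assumes \<Omega>: "\<Omega> \<in> sets lebesgue" and u: "H10_rel \<Omega> u G" and v: "H10_rel \<Omega> v H"
  shows "H10_rel \<Omega> (\<lambda>x. a *\<^sub>R u x + b *\<^sub>R v x) (\<lambda>x. a *\<^sub>R G x + b *\<^sub>R H x)"
proof -
  obtain \<phi> where \<phi>: "\<And>k. C1c \<Omega> (\<phi> k)" "(\<lambda>k. L2norm \<Omega> (\<lambda>x. \<phi> k x - u x)) \<longlonglongrightarrow> 0"
      "(\<lambda>k. L2norm \<Omega> (\<lambda>x. grad_C1 (\<phi> k) x - G x)) \<longlonglongrightarrow> 0"
    using u unfolding H10_rel_def by blast
  obtain \<psi> where \<psi>: "\<And>k. C1c \<Omega> (\<psi> k)" "(\<lambda>k. L2norm \<Omega> (\<lambda>x. \<psi> k x - v x)) \<longlonglongrightarrow> 0"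
      "(\<lambda>k. L2norm \<Omega> (\<lambda>x. grad_C1 (\<psi> k) x - H x)) \<longlonglongrightarrow> 0"
    using v unfolding H10_rel_def by blast
  note L2 = H10_rel_L2[OF u] H10_rel_L2[OF v]
  have lim: "(\<lambda>k. L2norm \<Omega> (\<lambda>x. a *\<^sub>R p k x + b *\<^sub>R q k x - (a *\<^sub>R P x + b *\<^sub>R Q x))) \<longlonglongrightarrow> 0"
    if "\<And>k. L2 \<Omega> (p k)" "\<And>k. L2 \<Omega> (q k)" "L2 \<Omega> P" "L2 \<Omega> Q"
      "(\<lambda>k. L2norm \<Omega> (\<lambda>x. p k x - P x)) \<longlonglongrightarrow> 0" "(\<lambda>k. L2norm \<Omega> (\<lambda>x. q k x - Q x)) \<longlonglongrightarrow> 0"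
    for p q :: "nat \<Rightarrow> real^'a \<Rightarrow> 'z::euclidean_space" and P Q
  proof (rule Lim_null_comparison[OF always_eventually], rule allI)
    fix k
    have "(\<lambda>x. a *\<^sub>R p k x + b *\<^sub>R q k x - (a *\<^sub>R P x + b *\<^sub>R Q x)) =
        (\<lambda>x. a *\<^sub>R (p k x - P x) + b *\<^sub>R (q k x - Q x))"
      by (simp add: fun_eq_iff algebra_simps)
    then have "L2norm \<Omega> (\<lambda>x. a *\<^sub>R p k x + b *\<^sub>R q k x - (a *\<^sub>R P x + b *\<^sub>R Q x)) \<le>
        \<bar>a\<bar> * L2norm \<Omega> (\<lambda>x. p k x - P x) + \<bar>b\<bar> * L2norm \<Omega> (\<lambda>x. q k x - Q x)"
      using L2norm_triangle[OF L2_scaleR[OF L2_diff[OF that(1,3)]] L2_scaleR[OF L2_diff[OF that(2,4)]], of a k b k]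
      by (simp add: L2norm_scaleR)
    then show "norm (L2norm \<Omega> (\<lambda>x. a *\<^sub>R p k x + b *\<^sub>R q k x - (a *\<^sub>R P x + b *\<^sub>R Q x))) \<le>
        \<bar>a\<bar> * L2norm \<Omega> (\<lambda>x. p k x - P x) + \<bar>b\<bar> * L2norm \<Omega> (\<lambda>x. q k x - Q x)"
      by (simp add: L2norm_nonneg)
  next
    show "(\<lambda>k. \<bar>a\<bar> * L2norm \<Omega> (\<lambda>x. p k x - P x) + \<bar>b\<bar> * L2norm \<Omega> (\<lambda>x. q k x - Q x)) \<longlonglongrightarrow> 0"
      using tendsto_add[OF tendsto_mult_right_zero[OF that(5), of "\<bar>a\<bar>"] tendsto_mult_right_zero[OF that(6), of "\<bar>b\<bar>"]]
      by simp
  qed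
  have "\<forall>k. C1c \<Omega> (\<lambda>x. a *\<^sub>R \<phi> k x + b *\<^sub>R \<psi> k x)"
    using C1c_lincomb(1)[OF \<phi>(1) \<psi>(1)] by blast
  moreover have "(\<lambda>k. L2norm \<Omega> (\<lambda>x. a *\<^sub>R \<phi> k x + b *\<^sub>R \<psi> k x - (a *\<^sub>R u x + b *\<^sub>R v x))) \<longlonglongrightarrow> 0"
    by (intro lim C1c_L2 \<Omega> \<phi> \<psi> L2)
  moreover have "(\<lambda>k. L2norm \<Omega> (\<lambda>x. grad_C1 (\<lambda>x. a *\<^sub>R \<phi> k x + b *\<^sub>R \<psi> k x) x - (a *\<^sub>R G x + b *\<^sub>R H x)))
      \<longlonglongrightarrow> 0"
    unfolding C1c_lincomb(2)[OF \<phi>(1) \<psi>(1)]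
    by (intro lim C1c_L2 \<Omega> \<phi> \<psi> L2)
  ultimately show ?thesis
    unfolding H10_rel_def using L2_add[OF L2_scaleR[OF L2(1)] L2_scaleR[OF L2(3)]]
      L2_add[OF L2_scaleR[OF L2(2)] L2_scaleR[OF L2(4)]]
    by (intro conjI exI[of _ "\<lambda>k x. a *\<^sub>R \<phi> k x + b *\<^sub>R \<psi> k x"]) auto
qed

lemma H10_rel_diff:
  assumes "\<Omega> \<in> sets lebesgue" "H10_rel \<Omega> u G" "H10_rel \<Omega> v H"
  shows "H10_rel \<Omega> (\<lambda>x. u x - v x) (\<lambda>x. G x - H x)"
  using H10_rel_lincomb[OF assms, of 1 "-1"] by simp

text \<open>Fatou's lemma along an almost everywhere convergent subsequence of smooth
  approximations: the right-hand sides converge because L2 norms do. Square integrability of the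
  product is part of the conclusion, since it is what makes the trilinear integrals below
  meaningful.\<close>

lemma H10_interpolation:
  fixes \<Omega> :: "(real^'n) set"
  assumes dim: "CARD('n) = 2 \<or> CARD('n) = 3" and \<Omega>: "\<Omega> \<in> sets lebesgue" "\<Omega> \<subseteq> cball 0 R" "R \<ge> 0"
    and u: "H10_rel \<Omega> u G" and v: "H10_rel \<Omega> v H"
  shows "L2 \<Omega> (\<lambda>x. norm (u x) * norm (v x))"
    and "(L2norm \<Omega> (\<lambda>x. norm (u x) * norm (v x)))\<^sup>2 \<le>
      sqrt (4096 + 256 * R\<^sup>2) * (L2norm \<Omega> G)\<^sup>2 * L2norm \<Omega> v * L2norm \<Omega> H"
proof -
  let ?M = "lebesgue_on \<Omega>"
  obtain \<phi> where \<phi>: "\<And>k. C1c \<Omega> (\<phi> k)" "(\<lambda>k. L2norm \<Omega> (\<lambda>x. \<phi> k x - u x)) \<longlonglongrightarrow> 0"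
      "(\<lambda>k. L2norm \<Omega> (\<lambda>x. grad_C1 (\<phi> k) x - G x)) \<longlonglongrightarrow> 0"
    using u unfolding H10_rel_def by blast
  obtain \<psi> where \<psi>: "\<And>k. C1c \<Omega> (\<psi> k)" "(\<lambda>k. L2norm \<Omega> (\<lambda>x. \<psi> k x - v x)) \<longlonglongrightarrow> 0"
      "(\<lambda>k. L2norm \<Omega> (\<lambda>x. grad_C1 (\<psi> k) x - H x)) \<longlonglongrightarrow> 0"
    using v unfolding H10_rel_def by blast
  note L2 = H10_rel_L2[OF u] H10_rel_L2[OF v]
  note L2\<phi> = C1c_L2[OF \<Omega>(1) \<phi>(1)] and L2\<psi> = C1c_L2[OF \<Omega>(1) \<psi>(1)]
  note [measurable] = L2_measurable[OF L2\<phi>(1)] L2_measurable[OF L2\<psi>(1)]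
  obtain r where r: "strict_mono r" "AE x in ?M. (\<lambda>k. \<phi> (r k) x) \<longlonglongrightarrow> u x"
    using L2_AE_subseq[OF L2(1) L2\<phi>(1) \<phi>(2)] .
  \<comment> \<open>The second subsequence is extracted from the first, so that both approximations
    converge almost everywhere along the same indices.\<close>
  have "(\<lambda>k. L2norm \<Omega> (\<lambda>x. \<psi> (r k) x - v x)) \<longlonglongrightarrow> 0"
    using LIMSEQ_subseq_LIMSEQ[OF \<psi>(2) r(1)] by (simp add: o_def)
  from L2_AE_subseq[OF L2(3) L2\<psi>(1) this] obtain s where s: "strict_mono s"
      "AE x in ?M. (\<lambda>k. \<psi> (r (s k)) x) \<longlonglongrightarrow> v x" .
  define t where "t k = r (s k)" for k
  have t: "strict_mono t"
    using strict_mono_o[OF r(1) s(1)] by (simp add: t_def[abs_def] o_def)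
  define f where "f k x = ennreal ((norm (\<phi> (t k) x) * norm (\<psi> (t k) x))\<^sup>2)" for k x
  define B where "B k = sqrt (4096 + 256 * R\<^sup>2) * (L2norm \<Omega> (grad_C1 (\<phi> (t k))))\<^sup>2 *
    L2norm \<Omega> (\<psi> (t k)) * L2norm \<Omega> (grad_C1 (\<psi> (t k)))" for k
  define C where "C = sqrt (4096 + 256 * R\<^sup>2) * (L2norm \<Omega> G)\<^sup>2 * L2norm \<Omega> v * L2norm \<Omega> H"
  have lims: "(\<lambda>k. L2norm \<Omega> (grad_C1 (\<phi> (t k)))) \<longlonglongrightarrow> L2norm \<Omega> G"
    "(\<lambda>k. L2norm \<Omega> (\<psi> (t k))) \<longlonglongrightarrow> L2norm \<Omega> v"
    "(\<lambda>k. L2norm \<Omega> (grad_C1 (\<psi> (t k)))) \<longlonglongrightarrow> L2norm \<Omega> H"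
    using LIMSEQ_subseq_LIMSEQ[OF tendsto_L2norm[OF L2(2) L2\<phi>(2) \<phi>(3)] t]
      LIMSEQ_subseq_LIMSEQ[OF tendsto_L2norm[OF L2(3) L2\<psi>(1) \<psi>(2)] t]
      LIMSEQ_subseq_LIMSEQ[OF tendsto_L2norm[OF L2(4) L2\<psi>(2) \<psi>(3)] t]
    by (simp_all add: o_def)
  have BC: "B \<longlonglongrightarrow> C"
    unfolding B_def C_def by (intro tendsto_intros lims)
  have C0: "C \<ge> 0"
    unfolding C_def by (simp add: L2norm_nonneg)
  have ae: "AE x in ?M. ennreal ((norm (u x) * norm (v x))\<^sup>2) = liminf (\<lambda>k. f k x)"
    using r(2) s(2)
  proof eventually_elim
    case (elim x)
    have "(\<lambda>k. \<phi> (t k) x) \<longlonglongrightarrow> u x"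
      using LIMSEQ_subseq_LIMSEQ[OF elim(1) s(1)] by (simp add: o_def t_def)
    then have "(\<lambda>k. f k x) \<longlonglongrightarrow> ennreal ((norm (u x) * norm (v x))\<^sup>2)"
      using elim(2) unfolding f_def t_def by (intro tendsto_ennrealI tendsto_intros)
    then show ?case
      by (simp add: lim_imp_Liminf)
  qed
  have "(\<integral>\<^sup>+x. ennreal ((norm (u x) * norm (v x))\<^sup>2) \<partial>?M) = (\<integral>\<^sup>+x. liminf (\<lambda>k. f k x) \<partial>?M)"
    by (rule nn_integral_cong_AE[OF ae])
  also have "\<dots> \<le> liminf (\<lambda>k. \<integral>\<^sup>+x. f k x \<partial>?M)"
    unfolding f_def by (intro nn_integral_liminf) measurable
  also have "\<dots> \<le> liminf (\<lambda>k. ennreal (B k))"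
    unfolding f_def B_def
    by (intro Liminf_mono always_eventually allI C1c_interpolation[OF dim \<Omega> \<phi>(1) \<psi>(1)])
  also have "\<dots> = ennreal C"
    by (intro lim_imp_Liminf tendsto_ennrealI BC) simp
  finally have le: "(\<integral>\<^sup>+x. ennreal ((norm (u x) * norm (v x))\<^sup>2) \<partial>?M) \<le> ennreal C" .
  show L2uv: "L2 \<Omega> (\<lambda>x. norm (u x) * norm (v x))"
    unfolding L2_iff_nn_integral
  proof
    show "(\<lambda>x. norm (u x) * norm (v x)) \<in> borel_measurable ?M"
      using L2_measurable[OF L2(1)] L2_measurable[OF L2(3)] by measurable
    show "(\<integral>\<^sup>+x. ennreal ((norm (norm (u x) * norm (v x)))\<^sup>2) \<partial>?M) < top"
      using le by (simp add: le_less_trans)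
  qed
  have "ennreal ((L2norm \<Omega> (\<lambda>x. norm (u x) * norm (v x)))\<^sup>2) \<le> ennreal C"
    using le unfolding ennreal_L2norm_sq[OF L2uv] by simp
  then show "(L2norm \<Omega> (\<lambda>x. norm (u x) * norm (v x)))\<^sup>2 \<le>
      sqrt (4096 + 256 * R\<^sup>2) * (L2norm \<Omega> G)\<^sup>2 * L2norm \<Omega> v * L2norm \<Omega> H"
    using C0 by (simp add: C_def)
qed

text \<open>Continuity serves only to make \<open>x \<mapsto> T (a x) (m x) (w x)\<close> measurable.\<close>

definition bounded_trilinear :: "('a::euclidean_space \<Rightarrow> 'b::euclidean_space \<Rightarrow> 'c::euclidean_space \<Rightarrow> real) \<Rightarrow> real \<Rightarrow> bool" where
  "bounded_trilinear T c \<longleftrightarrow> c \<ge> 0 \<and> (\<forall>a m w. \<bar>T a m w\<bar> \<le> c * (norm m * (norm a * norm w))) \<and>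
    continuous_on UNIV (\<lambda>(a, m, w). T a m w) \<and>
    (\<forall>a a' m w. T (a - a') m w = T a m w - T a' m w) \<and>
    (\<forall>a m m' w. T a (m - m') w = T a m w - T a m' w) \<and>
    (\<forall>a m w w'. T a m (w - w') = T a m w - T a m w')"

text \<open>Cauchy-Schwarz pairs the gradient factor \<open>m\<close> with the product of the two
  field norms. Three L2 factors alone would not be integrable; the hypothesis on the product is what
  interpolation delivers.\<close>

lemma bounded_trilinear_integral:
  fixes u :: "'n::euclidean_space \<Rightarrow> 'a::euclidean_space" and m :: "'n \<Rightarrow> 'b::euclidean_space"
    and w :: "'n \<Rightarrow> 'c::euclidean_space"
  assumes T: "bounded_trilinear T c"
    and meas: "u \<in> borel_measurable (lebesgue_on \<Omega>)" "w \<in> borel_measurable (lebesgue_on \<Omega>)"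
    and m: "L2 \<Omega> m" and uw: "L2 \<Omega> (\<lambda>x. norm (u x) * norm (w x))"
  shows "integrable (lebesgue_on \<Omega>) (\<lambda>x. T (u x) (m x) (w x))"
    and "\<bar>\<integral>x. T (u x) (m x) (w x) \<partial>lebesgue_on \<Omega>\<bar> \<le>
      c * (L2norm \<Omega> m * L2norm \<Omega> (\<lambda>x. norm (u x) * norm (w x)))"
proof -
  let ?M = "lebesgue_on \<Omega>"
  have le: "\<bar>T (u x) (m x) (w x)\<bar> \<le> c * (norm (m x) * norm (norm (u x) * norm (w x)))" for x
    using T unfolding bounded_trilinear_def by simp
  have i: "integrable ?M (\<lambda>x. c * (norm (m x) * norm (norm (u x) * norm (w x))))"
    by (intro integrable_mult_right L2_norm_mult_integrable m uw)
  have "(\<lambda>(a, m, w). T a m w) \<in> borel_measurable borel"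
    using T unfolding bounded_trilinear_def by (intro borel_measurable_continuous_onI) auto
  then have "(\<lambda>x. (\<lambda>(a, m, w). T a m w) (u x, m x, w x)) \<in> borel_measurable ?M"
    by (rule measurable_compose[rotated]) (intro borel_measurable_Pair meas L2_measurable[OF m])
  then show int: "integrable ?M (\<lambda>x. T (u x) (m x) (w x))"
    using le by (intro Bochner_Integration.integrable_bound[OF i]) (auto intro: order_trans[OF _ abs_ge_self])
  have "\<bar>\<integral>x. T (u x) (m x) (w x) \<partial>?M\<bar> \<le> (\<integral>x. c * (norm (m x) * norm (norm (u x) * norm (w x))) \<partial>?M)"
    using Bochner_Integration.integral_norm_bound_integral[OF int i] le by simp
  also have "\<dots> = c * (\<integral>x. norm (m x) * norm (norm (u x) * norm (w x)) \<partial>?M)"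
    by simp
  also have "\<dots> \<le> c * (L2norm \<Omega> m * L2norm \<Omega> (\<lambda>x. norm (u x) * norm (w x)))"
    using T L2_Cauchy_Schwarz_norm[OF m uw] unfolding bounded_trilinear_def by (intro mult_left_mono) auto
  finally show "\<bar>\<integral>x. T (u x) (m x) (w x) \<partial>?M\<bar> \<le>
      c * (L2norm \<Omega> m * L2norm \<Omega> (\<lambda>x. norm (u x) * norm (w x)))" .
qed

text \<open>The three arguments are exchanged one at a time. Each resulting integral contains one
  difference, which is again a field with a gradient (or a difference of L2 functions), so
  interpolation bounds it by quantities that tend to 0.\<close>

lemma bounded_trilinear_integral_tendsto:
  fixes \<Omega> :: "(real^'n) set" and m :: "real^'n \<Rightarrow> 'b::euclidean_space"
  assumes dim: "CARD('n) = 2 \<or> CARD('n) = 3" and \<Omega>: "\<Omega> \<in> sets lebesgue" "\<Omega> \<subseteq> cball 0 R" "R \<ge> 0"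
    and T: "bounded_trilinear T c"
    and u: "H10_rel \<Omega> u G" "\<And>k. H10_rel \<Omega> (u' k) (G' k)"
      "(\<lambda>k. L2norm \<Omega> (\<lambda>x. u' k x - u x)) \<longlonglongrightarrow> 0" "(\<lambda>k. L2norm \<Omega> (\<lambda>x. G' k x - G x)) \<longlonglongrightarrow> 0"
    and w: "H10_rel \<Omega> w H" "\<And>k. H10_rel \<Omega> (w' k) (H' k)"
      "(\<lambda>k. L2norm \<Omega> (\<lambda>x. w' k x - w x)) \<longlonglongrightarrow> 0" "(\<lambda>k. L2norm \<Omega> (\<lambda>x. H' k x - H x)) \<longlonglongrightarrow> 0"
    and m: "L2 \<Omega> m" "\<And>k. L2 \<Omega> (m' k)" "(\<lambda>k. L2norm \<Omega> (\<lambda>x. m' k x - m x)) \<longlonglongrightarrow> 0"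
  shows "(\<lambda>k. \<integral>x. T (u' k x) (m' k x) (w' k x) \<partial>lebesgue_on \<Omega>) \<longlonglongrightarrow>
    (\<integral>x. T (u x) (m x) (w x) \<partial>lebesgue_on \<Omega>)"
proof (rule LIM_zero_cancel, rule Lim_null_comparison[OF always_eventually], rule allI)
  let ?M = "lebesgue_on \<Omega>"
  define C where "C = sqrt (4096 + 256 * R\<^sup>2)"
  define E where "E k = c * (L2norm \<Omega> (m' k) *
      sqrt (C * (L2norm \<Omega> (\<lambda>x. G' k x - G x))\<^sup>2 * L2norm \<Omega> (w' k) * L2norm \<Omega> (H' k))) +
    c * (L2norm \<Omega> (\<lambda>x. m' k x - m x) *
      sqrt (C * (L2norm \<Omega> G)\<^sup>2 * L2norm \<Omega> (w' k) * L2norm \<Omega> (H' k))) +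
    c * (L2norm \<Omega> m *
      sqrt (C * (L2norm \<Omega> G)\<^sup>2 * L2norm \<Omega> (\<lambda>x. w' k x - w x) * L2norm \<Omega> (\<lambda>x. H' k x - H x)))" for k
  have c: "c \<ge> 0"
    using T unfolding bounded_trilinear_def by simp
  have bound: "integrable ?M (\<lambda>x. T (a x) (q x) (z x))"
    "\<bar>\<integral>x. T (a x) (q x) (z x) \<partial>?M\<bar> \<le>
      c * (L2norm \<Omega> q * sqrt (C * (L2norm \<Omega> A)\<^sup>2 * L2norm \<Omega> z * L2norm \<Omega> Z))"
    if "H10_rel \<Omega> a A" "H10_rel \<Omega> z Z" "L2 \<Omega> q" for a A z Z q
  proof -
    note I = H10_interpolation[OF dim \<Omega> that(1,2)]
    note B = bounded_trilinear_integral[OF T L2_measurable[OF H10_rel_L2(1)[OF that(1)]]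
        L2_measurable[OF H10_rel_L2(1)[OF that(2)]] that(3) I(1)]
    show "integrable ?M (\<lambda>x. T (a x) (q x) (z x))"
      by (rule B(1))
    have "L2norm \<Omega> (\<lambda>x. norm (a x) * norm (z x)) \<le> sqrt (C * (L2norm \<Omega> A)\<^sup>2 * L2norm \<Omega> z * L2norm \<Omega> Z)"
      using I(2) unfolding C_def by (rule real_le_rsqrt)
    then show "\<bar>\<integral>x. T (a x) (q x) (z x) \<partial>?M\<bar> \<le>
        c * (L2norm \<Omega> q * sqrt (C * (L2norm \<Omega> A)\<^sup>2 * L2norm \<Omega> z * L2norm \<Omega> Z))"
      using c by (intro order_trans[OF B(2)] mult_left_mono) (auto simp: L2norm_nonneg)
  qed
  fix k
  note du = H10_rel_diff[OF \<Omega>(1) u(2)[of k] u(1)] and dw = H10_rel_diff[OF \<Omega>(1) w(2)[of k] w(1)]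
    and dm = L2_diff[OF m(2)[of k] m(1)]
  \<comment> \<open>Telescoping: the first two terms still involve approximating factors, whose
    norms converge and hence stay bounded.\<close>
  have "T (u' k x) (m' k x) (w' k x) - T (u x) (m x) (w x) =
      T (u' k x - u x) (m' k x) (w' k x) + T (u x) (m' k x - m x) (w' k x) + T (u x) (m x) (w' k x - w x)" for x
    using T unfolding bounded_trilinear_def by simp
  then have "(\<integral>x. T (u' k x) (m' k x) (w' k x) \<partial>?M) - (\<integral>x. T (u x) (m x) (w x) \<partial>?M) =
      (\<integral>x. T (u' k x - u x) (m' k x) (w' k x) + T (u x) (m' k x - m x) (w' k x) + T (u x) (m x) (w' k x - w x) \<partial>?M)"
    using bound(1)[OF u(2) w(2) m(2)] bound(1)[OF u(1) w(1) m(1)]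
    by (simp flip: Bochner_Integration.integral_diff)
  also have "\<dots> = (\<integral>x. T (u' k x - u x) (m' k x) (w' k x) \<partial>?M) + (\<integral>x. T (u x) (m' k x - m x) (w' k x) \<partial>?M) +
      (\<integral>x. T (u x) (m x) (w' k x - w x) \<partial>?M)"
    using bound(1)[OF du w(2) m(2)] bound(1)[OF u(1) w(2) dm] bound(1)[OF u(1) dw m(1)] by simp
  also have "\<bar>\<dots>\<bar> \<le> E k"
    unfolding E_def
    using bound(2)[OF du w(2)[of k] m(2)[of k]] bound(2)[OF u(1) w(2)[of k] dm] bound(2)[OF u(1) dw m(1)]
    by linarith
  finally show "norm ((\<integral>x. T (u' k x) (m' k x) (w' k x) \<partial>?M) - (\<integral>x. T (u x) (m x) (w x) \<partial>?M)) \<le> E k"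
    by simp
next
  let ?C = "sqrt (4096 + 256 * R\<^sup>2)"
  note lims = tendsto_L2norm[OF m(1) m(2) m(3)] tendsto_L2norm[OF H10_rel_L2(1)[OF w(1)] H10_rel_L2(1)[OF w(2)] w(3)]
    tendsto_L2norm[OF H10_rel_L2(2)[OF w(1)] H10_rel_L2(2)[OF w(2)] w(4)]
  have "(\<lambda>k. c * (L2norm \<Omega> (m' k) *
      sqrt (?C * (L2norm \<Omega> (\<lambda>x. G' k x - G x))\<^sup>2 * L2norm \<Omega> (w' k) * L2norm \<Omega> (H' k))) +
    c * (L2norm \<Omega> (\<lambda>x. m' k x - m x) *
      sqrt (?C * (L2norm \<Omega> G)\<^sup>2 * L2norm \<Omega> (w' k) * L2norm \<Omega> (H' k))) +
    c * (L2norm \<Omega> m *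
      sqrt (?C * (L2norm \<Omega> G)\<^sup>2 * L2norm \<Omega> (\<lambda>x. w' k x - w x) * L2norm \<Omega> (\<lambda>x. H' k x - H x))))
    \<longlonglongrightarrow> c * (L2norm \<Omega> m * sqrt (?C * 0\<^sup>2 * L2norm \<Omega> w * L2norm \<Omega> H)) +
     c * (0 * sqrt (?C * (L2norm \<Omega> G)\<^sup>2 * L2norm \<Omega> w * L2norm \<Omega> H)) +
     c * (L2norm \<Omega> m * sqrt (?C * (L2norm \<Omega> G)\<^sup>2 * 0 * 0))"
    by (intro tendsto_intros lims u w m)
  then show "(\<lambda>k. c * (L2norm \<Omega> (m' k) *
      sqrt (?C * (L2norm \<Omega> (\<lambda>x. G' k x - G x))\<^sup>2 * L2norm \<Omega> (w' k) * L2norm \<Omega> (H' k))) +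
    c * (L2norm \<Omega> (\<lambda>x. m' k x - m x) *
      sqrt (?C * (L2norm \<Omega> G)\<^sup>2 * L2norm \<Omega> (w' k) * L2norm \<Omega> (H' k))) +
    c * (L2norm \<Omega> m *
      sqrt (?C * (L2norm \<Omega> G)\<^sup>2 * L2norm \<Omega> (\<lambda>x. w' k x - w x) * L2norm \<Omega> (\<lambda>x. H' k x - H x)))) \<longlonglongrightarrow> 0"
    by simp
qed

section \<open>Integration by parts and the convective term\<close>

lemma bounded_trilinear_advection:
  "bounded_trilinear (\<lambda>(a::real^'n) (m::real^'n^'n) w. (m *v a) \<bullet> w) 1"
proof -
  have "\<bar>(m *v a) \<bullet> w\<bar> \<le> norm m * (norm a * norm w)" for a w :: "real^'n" and m :: "real^'n^'n"
    using Cauchy_Schwarz_ineq2[of "m *v a" w]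
      mult_right_mono[OF norm_matrix_vector_mult_le[of m a], of "norm w"] by (simp add: mult.assoc)
  moreover have "continuous_on UNIV (\<lambda>(a :: real^'n, m :: real^'n^'n, w). (m *v a) \<bullet> w)"
    unfolding case_prod_beta
    by (intro continuous_intros bounded_bilinear.continuous_on[OF bounded_bilinear_matrix_vector_mult])
  ultimately show ?thesis
    unfolding bounded_trilinear_def
    by (simp add: inner_diff_left inner_diff_right bounded_bilinear.diff_left[OF bounded_bilinear_matrix_vector_mult]
        bounded_bilinear.diff_right[OF bounded_bilinear_matrix_vector_mult])
qed

lemma bounded_trilinear_divergence:
  "bounded_trilinear (\<lambda>(a::real^'n) (m::real^'n^'n) w. trace m * (a \<bullet> w)) (real CARD('n))"
proof -
  have "\<bar>trace m * (a \<bullet> w)\<bar> \<le> real CARD('n) * (norm m * (norm a * norm w))"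
    for a w :: "real^'n" and m :: "real^'n^'n"
    using mult_mono[OF abs_trace_le[of m] Cauchy_Schwarz_ineq2[of a w]] by (simp add: abs_mult mult.assoc)
  moreover have "continuous_on UNIV (\<lambda>(a :: real^'n, m :: real^'n^'n, w). trace m * (a \<bullet> w))"
    unfolding case_prod_beta trace_def by (intro continuous_intros)
  ultimately show ?thesis
    unfolding bounded_trilinear_def
    by (simp add: inner_diff_left inner_diff_right trace_def sum_subtractf algebra_simps)
qed

lemma C1_compact_bounded_linear:
  assumes L: "bounded_linear L" and f: "C1_compact f D"
  shows "C1_compact (\<lambda>x. L (f x)) (\<lambda>x h. L (D x h))"
proof -
  have "L 0 = 0"
    using L by (simp add: linear_0 bounded_linear.linear)
  then show ?thesis
    using f unfolding C1_compact_def
    by (auto intro!: bounded_linear.has_derivative[OF L] bounded_linear.continuous_on[OF L])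
qed

text \<open>The integrand is the divergence of the compactly supported field obtained by scaling
  \<open>e\<close> with the inner product of \<open>u\<close> and \<open>w\<close>.\<close>

lemma C1c_integration_by_parts:
  fixes \<Omega> :: "(real^'n) set"
  assumes \<Omega>: "\<Omega> \<in> sets lebesgue" and e: "C1c \<Omega> e" and u: "C1c \<Omega> u" and w: "C1c \<Omega> w"
  shows "(\<integral>x. (grad_C1 u x *v e x) \<bullet> w x + (grad_C1 w x *v e x) \<bullet> u x + trace (grad_C1 e x) * (u x \<bullet> w x)
    \<partial>lebesgue_on \<Omega>) = 0"
proof -
  define F where "F x = (grad_C1 u x *v e x) \<bullet> w x + (grad_C1 w x *v e x) \<bullet> u x +
    trace (grad_C1 e x) * (u x \<bullet> w x)" for x
  define D1 where "D1 x h = u x \<bullet> (grad_C1 w x *v h) + (grad_C1 u x *v h) \<bullet> w x" for x h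
  \<comment> \<open>\<open>D1\<close> is the derivative of the inner product of \<open>u\<close> and
    \<open>w\<close>, and \<open>D2 i\<close> that of this inner product times the i-th component of
    \<open>e\<close>. The divergence is the sum of the \<open>D2 i\<close> along the i-th
    axis.\<close>
  define D2 where "D2 i x h = (u x \<bullet> w x) * (grad_C1 e x *v h) $ i + D1 x h * e x $ i" for i x h
  have C: "C1_compact (\<lambda>x. (u x \<bullet> w x) * e x $ i) (D2 i)" for i
    unfolding D2_def D1_def
    by (intro C1_compact_bilinear[OF bounded_bilinear_mult] C1_compact_bilinear[OF bounded_bilinear_inner]
        C1_compact_bounded_linear[OF bounded_linear_vec_nth] C1c_C1_compact[of \<Omega>] e u w)
  have D1e: "(\<Sum>i\<in>UNIV. D1 x (axis i 1) * e x $ i) = D1 x (e x)" for x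
  proof -
    have lin: "linear (D1 x)"
      unfolding D1_def by (intro linearI) (simp_all add: matrix_vector_right_distrib matrix_vector_mult_scaleR inner_add_left
          inner_add_right algebra_simps)
    have "D1 x (e x) = D1 x (\<Sum>i\<in>UNIV. e x $ i *\<^sub>R axis i 1)"
      using basis_expansion[of "e x"] by (simp add: scalar_mult_eq_scaleR)
    also have "\<dots> = (\<Sum>i\<in>UNIV. D1 x (axis i 1) * e x $ i)"
      by (simp add: linear_sum[OF lin] linear_scale[OF lin] mult.commute)
    finally show ?thesis
      by simp
  qed
  have F: "F x = (\<Sum>i\<in>UNIV. D2 i x (axis i 1))" for x
    unfolding D2_def sum.distrib D1e
    by (simp add: F_def D1_def trace_def matrix_vector_mult_basis column_def sum_distrib_left inner_commute mult.commute)
  have Fm: "F \<in> borel_measurable borel"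
    unfolding F[abs_def] using C1_compact_borel(2)[OF C] by measurable
  have "(\<integral>x. F x \<partial>lebesgue_on \<Omega>) = (\<integral>x. F x \<partial>lborel)"
    by (rule integral_lebesgue_on_support[OF \<Omega> _ Fm])
      (simp add: F_def C1c_zero_outside[OF e] trace_def)
  also have "\<dots> = 0"
    unfolding F using C1_compact_integral_derivative[OF C] by (simp add: Bochner_Integration.integral_sum)
  finally show ?thesis
    unfolding F_def .
qed

text \<open>Each of the three integrals is a bounded trilinear form with exactly one gradient among
  its arguments, so each passes to the limit separately. The limit gradients are the given ones,
  which is why any choice is admissible.\<close>

lemma H10_integration_by_parts:
  fixes \<Omega> :: "(real^'n) set"
  assumes dim: "CARD('n) = 2 \<or> CARD('n) = 3" and \<Omega>: "\<Omega> \<in> sets lebesgue" "\<Omega> \<subseteq> cball 0 R" "R \<ge> 0"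
    and e: "H10_rel \<Omega> e Ge" and u: "H10_rel \<Omega> u Gu" and w: "H10_rel \<Omega> w Gw"
  shows "(\<integral>x. (Gu x *v e x) \<bullet> w x \<partial>lebesgue_on \<Omega>) + (\<integral>x. (Gw x *v e x) \<bullet> u x \<partial>lebesgue_on \<Omega>) +
    (\<integral>x. trace (Ge x) * (u x \<bullet> w x) \<partial>lebesgue_on \<Omega>) = 0"
proof -
  have approx: "\<exists>\<phi>. (\<forall>k. C1c \<Omega> (\<phi> k)) \<and> (\<forall>k. H10_rel \<Omega> (\<phi> k) (grad_C1 (\<phi> k))) \<and>
      (\<lambda>k. L2norm \<Omega> (\<lambda>x. \<phi> k x - v x)) \<longlonglongrightarrow> 0 \<and> (\<lambda>k. L2norm \<Omega> (\<lambda>x. grad_C1 (\<phi> k) x - G x)) \<longlonglongrightarrow> 0"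
    if "H10_rel \<Omega> v G" for v G
    using that H10_rel_C1c[OF \<Omega>(1)] unfolding H10_rel_def[of \<Omega> v G] by blast
  obtain e' where e': "\<And>k. C1c \<Omega> (e' k)" "\<And>k. H10_rel \<Omega> (e' k) (grad_C1 (e' k))"
      "(\<lambda>k. L2norm \<Omega> (\<lambda>x. e' k x - e x)) \<longlonglongrightarrow> 0" "(\<lambda>k. L2norm \<Omega> (\<lambda>x. grad_C1 (e' k) x - Ge x)) \<longlonglongrightarrow> 0"
    using approx[OF e] by blast
  obtain u' where u': "\<And>k. C1c \<Omega> (u' k)" "\<And>k. H10_rel \<Omega> (u' k) (grad_C1 (u' k))"
      "(\<lambda>k. L2norm \<Omega> (\<lambda>x. u' k x - u x)) \<longlonglongrightarrow> 0" "(\<lambda>k. L2norm \<Omega> (\<lambda>x. grad_C1 (u' k) x - Gu x)) \<longlonglongrightarrow> 0"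
    using approx[OF u] by blast
  obtain w' where w': "\<And>k. C1c \<Omega> (w' k)" "\<And>k. H10_rel \<Omega> (w' k) (grad_C1 (w' k))"
      "(\<lambda>k. L2norm \<Omega> (\<lambda>x. w' k x - w x)) \<longlonglongrightarrow> 0" "(\<lambda>k. L2norm \<Omega> (\<lambda>x. grad_C1 (w' k) x - Gw x)) \<longlonglongrightarrow> 0"
    using approx[OF w] by blast
  let ?I1 = "\<lambda>k. \<integral>x. (grad_C1 (u' k) x *v e' k x) \<bullet> w' k x \<partial>lebesgue_on \<Omega>"
  let ?I2 = "\<lambda>k. \<integral>x. (grad_C1 (w' k) x *v e' k x) \<bullet> u' k x \<partial>lebesgue_on \<Omega>"
  let ?I3 = "\<lambda>k. \<integral>x. trace (grad_C1 (e' k) x) * (u' k x \<bullet> w' k x) \<partial>lebesgue_on \<Omega>"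
  note L2' = H10_rel_L2(2)
  have lim1: "?I1 \<longlonglongrightarrow> (\<integral>x. (Gu x *v e x) \<bullet> w x \<partial>lebesgue_on \<Omega>)"
    by (rule bounded_trilinear_integral_tendsto[OF dim \<Omega> bounded_trilinear_advection e e'(2-4) w w'(2-4)
          L2'[OF u] L2'[OF u'(2)] u'(4)])
  have lim2: "?I2 \<longlonglongrightarrow> (\<integral>x. (Gw x *v e x) \<bullet> u x \<partial>lebesgue_on \<Omega>)"
    by (rule bounded_trilinear_integral_tendsto[OF dim \<Omega> bounded_trilinear_advection e e'(2-4) u u'(2-4)
          L2'[OF w] L2'[OF w'(2)] w'(4)])
  have lim3: "?I3 \<longlonglongrightarrow> (\<integral>x. trace (Ge x) * (u x \<bullet> w x) \<partial>lebesgue_on \<Omega>)"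
    by (rule bounded_trilinear_integral_tendsto[OF dim \<Omega> bounded_trilinear_divergence u u'(2-4) w w'(2-4)
          L2'[OF e] L2'[OF e'(2)] e'(4)])
  have "?I1 k + ?I2 k + ?I3 k = 0" for k
  proof -
    have int: "integrable (lebesgue_on \<Omega>) (\<lambda>x. T (a x) (m x) (z x))"
      if "bounded_trilinear T c" "H10_rel \<Omega> a A" "H10_rel \<Omega> z Z" "L2 \<Omega> m" for T c a A z Z m
      by (rule bounded_trilinear_integral(1)[OF that(1) L2_measurable[OF H10_rel_L2(1)[OF that(2)]]
            L2_measurable[OF H10_rel_L2(1)[OF that(3)]] that(4) H10_interpolation(1)[OF dim \<Omega> that(2,3)]])
    show ?thesis
      using C1c_integration_by_parts[OF \<Omega>(1) e'(1) u'(1) w'(1), of k k k]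
        int[OF bounded_trilinear_advection e'(2) w'(2) L2'[OF u'(2)], of k k k]
        int[OF bounded_trilinear_advection e'(2) u'(2) L2'[OF w'(2)], of k k k]
        int[OF bounded_trilinear_divergence u'(2) w'(2) L2'[OF e'(2)], of k k k]
      by simp
  qed
  then have "(\<lambda>k. 0) \<longlonglongrightarrow> (\<integral>x. (Gu x *v e x) \<bullet> w x \<partial>lebesgue_on \<Omega>) +
      (\<integral>x. (Gw x *v e x) \<bullet> u x \<partial>lebesgue_on \<Omega>) + (\<integral>x. trace (Ge x) * (u x \<bullet> w x) \<partial>lebesgue_on \<Omega>)"
    using tendsto_add[OF tendsto_add[OF lim1 lim2] lim3] by simp
  then show ?thesis
    by (simp add: LIMSEQ_const_iff)
qed

text \<open>Integrating by parts twice moves every derivative off the small factor \<open>d\<close>; this is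
  what produces \<open>h\<^sup>-\<^sup>1\<^sup>/\<^sup>2\<close> instead of \<open>h\<^sup>-\<^sup>1\<close> below.\<close>

lemma skew_trilinear_estimate:
  fixes \<Omega> :: "(real^'n) set"
  assumes dim: "CARD('n) = 2 \<or> CARD('n) = 3" and \<Omega>: "\<Omega> \<in> sets lebesgue" "\<Omega> \<subseteq> cball 0 R" "R \<ge> 0"
    and e: "H10_rel \<Omega> e Ge" and u: "H10_rel \<Omega> u Gu" and d: "H10_rel \<Omega> d Gd" and ud: "\<And>x. u x - e x = d x"
    and inv: "L2norm \<Omega> Gd \<le> \<kappa> * L2norm \<Omega> d"
  shows "\<bar>1/2 * L2ip \<Omega> (\<lambda>x. Ge x *v e x) u - 1/2 * L2ip \<Omega> (\<lambda>x. Gu x *v e x) e\<bar> \<le>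
    (1 + real CARD('n) / 2) * sqrt (sqrt (4096 + 256 * R\<^sup>2) * \<kappa>) * L2norm \<Omega> Ge * L2norm \<Omega> Gu * L2norm \<Omega> d"
proof -
  let ?M = "lebesgue_on \<Omega>"
  define S where "S = sqrt (sqrt (4096 + 256 * R\<^sup>2) * \<kappa>)"
  note L2 = H10_rel_L2[OF e] H10_rel_L2[OF u] H10_rel_L2[OF d]
  have bound: "integrable ?M (\<lambda>x. T (a x) (m x) (z x))"
    "\<bar>\<integral>x. T (a x) (m x) (z x) \<partial>?M\<bar> \<le> c * (L2norm \<Omega> m * L2norm \<Omega> (\<lambda>x. norm (a x) * norm (z x)))"
    if "bounded_trilinear T c" "H10_rel \<Omega> a A" "H10_rel \<Omega> z Z" "L2 \<Omega> m" for T c a A z Z m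
    by (rule bounded_trilinear_integral[OF that(1) L2_measurable[OF H10_rel_L2(1)[OF that(2)]]
          L2_measurable[OF H10_rel_L2(1)[OF that(3)]] that(4) H10_interpolation(1)[OF dim \<Omega> that(2,3)]])+
  \<comment> \<open>Interpolation gives the square root of the product of the norms of
    \<open>d\<close> and its gradient. The inverse inequality replaces the gradient, leaving one
    full power of the norm of \<open>d\<close> and the root of \<open>\<kappa>\<close>, which will
    be \<open>Cinv / h\<close>.\<close>
  have Nd: "L2norm \<Omega> (\<lambda>x. norm (a x) * norm (d x)) \<le> S * L2norm \<Omega> A * L2norm \<Omega> d" if "H10_rel \<Omega> a A" for a A
  proof -
    have "(L2norm \<Omega> (\<lambda>x. norm (a x) * norm (d x)))\<^sup>2 \<le>
        sqrt (4096 + 256 * R\<^sup>2) * (L2norm \<Omega> A)\<^sup>2 * L2norm \<Omega> d * (\<kappa> * L2norm \<Omega> d)"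
      by (intro order_trans[OF H10_interpolation(2)[OF dim \<Omega> that d]] mult_left_mono inv)
        (simp add: L2norm_nonneg)
    then have "L2norm \<Omega> (\<lambda>x. norm (a x) * norm (d x)) \<le>
        sqrt (sqrt (4096 + 256 * R\<^sup>2) * (L2norm \<Omega> A)\<^sup>2 * L2norm \<Omega> d * (\<kappa> * L2norm \<Omega> d))"
      by (rule real_le_rsqrt)
    also have "\<dots> = sqrt ((sqrt (4096 + 256 * R\<^sup>2) * \<kappa>) * ((L2norm \<Omega> A)\<^sup>2 * (L2norm \<Omega> d)\<^sup>2))"
      by (simp add: power2_eq_square mult_ac)
    also have "\<dots> = S * L2norm \<Omega> A * L2norm \<Omega> d"
      by (simp only: S_def real_sqrt_mult real_sqrt_abs abs_of_nonneg[OF L2norm_nonneg] mult.assoc)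
    finally show ?thesis .
  qed
  define P Q V W where "P = (\<integral>x. (Gu x *v e x) \<bullet> e x \<partial>?M)" and "Q = (\<integral>x. (Gu x *v e x) \<bullet> u x \<partial>?M)"
    and "V = (\<integral>x. trace (Ge x) * (u x \<bullet> e x) \<partial>?M)" and "W = (\<integral>x. trace (Ge x) * (u x \<bullet> u x) \<partial>?M)"
  have ibp: "P + L2ip \<Omega> (\<lambda>x. Ge x *v e x) u + V = 0" "Q + Q + W = 0"
    using H10_integration_by_parts[OF dim \<Omega> e u e] H10_integration_by_parts[OF dim \<Omega> e u u]
    unfolding P_def Q_def V_def W_def L2ip_def by simp_all
  have QP: "Q - P = (\<integral>x. (Gu x *v e x) \<bullet> d x \<partial>?M)"
    unfolding P_def Q_def using bound(1)[OF bounded_trilinear_advection e u L2(4)]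
      bound(1)[OF bounded_trilinear_advection e e L2(4)]
    by (simp add: inner_diff_right flip: ud Bochner_Integration.integral_diff)
  have WV: "W - V = (\<integral>x. trace (Ge x) * (u x \<bullet> d x) \<partial>?M)"
    unfolding V_def W_def using bound(1)[OF bounded_trilinear_divergence u u L2(2)]
      bound(1)[OF bounded_trilinear_divergence u e L2(2)]
    by (simp add: inner_diff_right right_diff_distrib flip: ud Bochner_Integration.integral_diff)
  \<comment> \<open>The first identity turns the left side into \<open>- P - V / 2\<close>. Adding
    \<open>Q + W / 2\<close>, which is 0 by the second, groups the terms into differences that
    contain \<open>d\<close> as a factor.\<close>
  have "1/2 * L2ip \<Omega> (\<lambda>x. Ge x *v e x) u - 1/2 * L2ip \<Omega> (\<lambda>x. Gu x *v e x) e = (Q - P) + 1/2 * (W - V)"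
    using ibp unfolding P_def L2ip_def by argo
  then have "\<bar>1/2 * L2ip \<Omega> (\<lambda>x. Ge x *v e x) u - 1/2 * L2ip \<Omega> (\<lambda>x. Gu x *v e x) e\<bar> \<le> \<bar>Q - P\<bar> + 1/2 * \<bar>W - V\<bar>"
    using abs_triangle_ineq[of "Q - P" "1/2 * (W - V)"] by (simp only: abs_mult)
  also have "\<bar>Q - P\<bar> \<le> L2norm \<Omega> Gu * (S * L2norm \<Omega> Ge * L2norm \<Omega> d)"
    using order_trans[OF bound(2)[OF bounded_trilinear_advection e d L2(4)]]
      mult_left_mono[OF Nd[OF e] L2norm_nonneg[of \<Omega> Gu]] unfolding QP by simp
  also have "\<bar>W - V\<bar> \<le> real CARD('n) * (L2norm \<Omega> Ge * (S * L2norm \<Omega> Gu * L2norm \<Omega> d))"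
    unfolding WV
    by (intro order_trans[OF bound(2)[OF bounded_trilinear_divergence u d L2(2)]] mult_left_mono Nd[OF u])
      (simp_all add: L2norm_nonneg)
  finally show ?thesis
    unfolding S_def[symmetric] by (simp add: algebra_simps)
qed

section \<open>Energy estimate\<close>

lemma H10_0:
  fixes \<Omega> :: "(real^'n) set"
  assumes "\<Omega> \<in> sets lebesgue"
  shows "(\<lambda>x. 0) \<in> H10 \<Omega>"
proof -
  have "grad_C1 (\<lambda>x. 0 :: real^'n) = (\<lambda>x. 0)"
  proof (intro ext grad_C1_eq)
    have "(*v) (0 :: real^'n^'n) = (\<lambda>h. 0)"
      by (simp add: fun_eq_iff)
    then show "((\<lambda>x. 0 :: real^'n) has_derivative (*v) 0) (at x)" for x :: "real^'n"
      by simp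
  qed
  then have "C1c \<Omega> (\<lambda>x. 0)"
    unfolding C1c_def by (auto intro!: exI[of _ "{}"])
  then show ?thesis
    using H10_rel_C1c[OF assms] unfolding H10_def by blast
qed

lemma H10_lincomb:
  assumes "\<Omega> \<in> sets lebesgue" "u \<in> H10 \<Omega>" "v \<in> H10 \<Omega>"
  shows "(\<lambda>x. a *\<^sub>R u x + b *\<^sub>R v x) \<in> H10 \<Omega>"
  using assms H10_rel_lincomb[OF assms(1)] unfolding H10_def by blast

lemma H10_rel_wgrad: "u \<in> H10 \<Omega> \<Longrightarrow> H10_rel \<Omega> u (wgrad \<Omega> u)"
  unfolding H10_def wgrad_def by (simp add: someI_ex)

lemma fspan_subset_H10:
  assumes \<Omega>: "\<Omega> \<in> sets lebesgue" and B: "finite B" "B \<subseteq> H10 \<Omega>"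
  shows "fspan B \<subseteq> H10 \<Omega>"
proof -
  have "(\<lambda>x. \<Sum>b\<in>B. c b *\<^sub>R b x) \<in> H10 \<Omega>" for c
    using B
  proof (induction rule: finite_induct)
    case empty
    then show ?case
      using H10_0[OF \<Omega>] by simp
  next
    case (insert b B)
    then show ?case
      using H10_lincomb[OF \<Omega>, of b "\<lambda>x. \<Sum>b\<in>B. c b *\<^sub>R b x" "c b" 1] by simp
  qed
  then show ?thesis
    unfolding fspan_def by auto
qed

lemma fspan_lincomb:
  assumes "u \<in> fspan B" "v \<in> fspan B"
  shows "(\<lambda>x. a *\<^sub>R u x + b *\<^sub>R v x) \<in> fspan B"
proof -
  obtain c d where "u = (\<lambda>x. \<Sum>b\<in>B. c b *\<^sub>R b x)" "v = (\<lambda>x. \<Sum>b\<in>B. d b *\<^sub>R b x)"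
    using assms unfolding fspan_def by auto
  then have "(\<lambda>x. a *\<^sub>R u x + b *\<^sub>R v x) = (\<lambda>x. \<Sum>i\<in>B. (a * c i + b * d i) *\<^sub>R i x)"
    by (simp add: scaleR_sum_right scaleR_add_left sum.distrib)
  then show ?thesis
    unfolding fspan_def by (auto intro!: exI[of _ "\<lambda>i. a * c i + b * d i"])
qed

text \<open>A real supremum bounds its members only if the set is bounded above, and this is the
  continuity clause of \<open>Hminus1\<close>. The same clause forces \<open>f v = 0\<close> when
  the gradient norm is 0, a case that the supremum leaves out.\<close>

lemma le_dualnorm:
  assumes f: "Hminus1 \<Omega> f" and v: "v \<in> H10 \<Omega>"
  shows "f v \<le> dualnorm \<Omega> f * L2norm \<Omega> (wgrad \<Omega> v)"
proof -
  obtain K where K: "\<And>v. v \<in> H10 \<Omega> \<Longrightarrow> \<bar>f v\<bar> \<le> K * L2norm \<Omega> (wgrad \<Omega> v)"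
    using f unfolding Hminus1_def by blast
  show ?thesis
  proof (cases "L2norm \<Omega> (wgrad \<Omega> v) = 0")
    case True
    then show ?thesis
      using K[OF v] by simp
  next
    case False
    have pos: "L2norm \<Omega> (wgrad \<Omega> w) > 0" if "L2norm \<Omega> (wgrad \<Omega> w) \<noteq> 0" for w
      using that L2norm_nonneg[of \<Omega> "wgrad \<Omega> w"] by linarith
    have "f v / L2norm \<Omega> (wgrad \<Omega> v) \<le> dualnorm \<Omega> f"
      unfolding dualnorm_def
    proof (rule cSUP_upper)
      show "bdd_above ((\<lambda>v. f v / L2norm \<Omega> (wgrad \<Omega> v)) ` {v \<in> H10 \<Omega>. L2norm \<Omega> (wgrad \<Omega> v) \<noteq> 0})"
      proof (rule bdd_aboveI2)
        fix w assume w: "w \<in> {v \<in> H10 \<Omega>. L2norm \<Omega> (wgrad \<Omega> v) \<noteq> 0}"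
        then have "f w \<le> K * L2norm \<Omega> (wgrad \<Omega> w)"
          using K[of w] by auto
        then show "f w / L2norm \<Omega> (wgrad \<Omega> w) \<le> K"
          using pos[of w] w by (simp add: pos_divide_le_eq)
      qed
    qed (use v False in simp)
    then show ?thesis
      using pos[OF False] by (simp add: pos_divide_le_eq)
  qed
qed

text \<open>The parallelogram identity for \<open>U - V \<plusminus> \<omega> (V - W)\<close>: the sum of the two squares is at most
  \<open>2 (1 + \<omega>\<^sup>2)\<close> times \<open>\<bar>U - V\<bar>\<^sup>2 + \<bar>V - W\<bar>\<^sup>2\<close>. The minus sign gives the extrapolation error.\<close>

lemma BE_AB2_energy_pointwise:
  fixes U V W :: "'b::real_inner" and \<omega> :: real
  shows "1/2 * (norm U)\<^sup>2 - 1/2 * (norm V)\<^sup>2 + 1/4 * (norm (U - V))\<^sup>2 - 1/4 * (norm (V - W))\<^sup>2 +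
      1 / (8 * (1 + \<omega>\<^sup>2)) * (norm (U - V + \<omega> *\<^sub>R (V - W)))\<^sup>2 +
      1 / (8 * (1 + \<omega>\<^sup>2)) * (norm (U - ((1 + \<omega>) *\<^sub>R V - \<omega> *\<^sub>R W)))\<^sup>2 \<le> (U - V) \<bullet> U"
proof -
  define a b where "a = U - V" and "b = V - W"
  have pos: "1 + \<omega>\<^sup>2 > 0"
    by (simp add: add_pos_nonneg)
  have E: "U - ((1 + \<omega>) *\<^sub>R V - \<omega> *\<^sub>R W) = a - \<omega> *\<^sub>R b"
    by (simp add: a_def b_def algebra_simps)
  have "(norm (a + \<omega> *\<^sub>R b))\<^sup>2 + (norm (a - \<omega> *\<^sub>R b))\<^sup>2 = 2 * (norm a)\<^sup>2 + 2 * \<omega>\<^sup>2 * (norm b)\<^sup>2"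
    unfolding power2_norm_eq_inner
    by (simp add: inner_add_left inner_add_right inner_diff_left inner_diff_right power2_eq_square algebra_simps)
  also have "\<dots> \<le> 2 * (1 + \<omega>\<^sup>2) * ((norm a)\<^sup>2 + (norm b)\<^sup>2)"
    by (simp add: algebra_simps)
  finally have "1 / (8 * (1 + \<omega>\<^sup>2)) * ((norm (a + \<omega> *\<^sub>R b))\<^sup>2 + (norm (a - \<omega> *\<^sub>R b))\<^sup>2) \<le>
      1 / (8 * (1 + \<omega>\<^sup>2)) * (2 * (1 + \<omega>\<^sup>2) * ((norm a)\<^sup>2 + (norm b)\<^sup>2))"
    using pos by (intro mult_left_mono) auto
  also have "\<dots> = 1/4 * ((norm a)\<^sup>2 + (norm b)\<^sup>2)"
    using pos by (simp add: field_simps)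
  finally have "1 / (8 * (1 + \<omega>\<^sup>2)) * (norm (a + \<omega> *\<^sub>R b))\<^sup>2 + 1 / (8 * (1 + \<omega>\<^sup>2)) * (norm (a - \<omega> *\<^sub>R b))\<^sup>2 \<le>
      1/4 * (norm a)\<^sup>2 + 1/4 * (norm b)\<^sup>2"
    by (simp only: distrib_left)
  moreover have "(U - V) \<bullet> U = 1/2 * (norm U)\<^sup>2 - 1/2 * (norm V)\<^sup>2 + 1/2 * (norm a)\<^sup>2"
    by (simp add: a_def power2_norm_eq_inner inner_diff_left inner_diff_right inner_commute algebra_simps)
  ultimately show ?thesis
    unfolding E unfolding a_def[symmetric] b_def[symmetric] by linarith
qed

lemma BE_AB2_energy_L2:
  fixes u v w :: "'a::euclidean_space \<Rightarrow> 'b::euclidean_space" and \<omega> :: real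
  assumes "L2 \<Omega> u" "L2 \<Omega> v" "L2 \<Omega> w"
  shows "1/2 * (L2norm \<Omega> u)\<^sup>2 - 1/2 * (L2norm \<Omega> v)\<^sup>2 + 1/4 * (L2norm \<Omega> (\<lambda>x. u x - v x))\<^sup>2 -
      1/4 * (L2norm \<Omega> (\<lambda>x. v x - w x))\<^sup>2 +
      1 / (8 * (1 + \<omega>\<^sup>2)) * (L2norm \<Omega> (\<lambda>x. u x - v x + \<omega> *\<^sub>R (v x - w x)))\<^sup>2 +
      1 / (8 * (1 + \<omega>\<^sup>2)) * (L2norm \<Omega> (\<lambda>x. u x - ((1 + \<omega>) *\<^sub>R v x - \<omega> *\<^sub>R w x)))\<^sup>2 \<le>
    L2ip \<Omega> (\<lambda>x. u x - v x) u"
proof -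
  have int: "integrable (lebesgue_on \<Omega>) (\<lambda>x. (norm (u x))\<^sup>2)" "integrable (lebesgue_on \<Omega>) (\<lambda>x. (norm (v x))\<^sup>2)"
    "integrable (lebesgue_on \<Omega>) (\<lambda>x. (norm (u x - v x))\<^sup>2)" "integrable (lebesgue_on \<Omega>) (\<lambda>x. (norm (v x - w x))\<^sup>2)"
    "integrable (lebesgue_on \<Omega>) (\<lambda>x. (norm (u x - v x + \<omega> *\<^sub>R (v x - w x)))\<^sup>2)"
    "integrable (lebesgue_on \<Omega>) (\<lambda>x. (norm (u x - ((1 + \<omega>) *\<^sub>R v x - \<omega> *\<^sub>R w x)))\<^sup>2)"
    by (intro L2_integrable_sq L2_add L2_diff L2_scaleR assms)+
  have "(\<integral>x. 1/2 * (norm (u x))\<^sup>2 - 1/2 * (norm (v x))\<^sup>2 + 1/4 * (norm (u x - v x))\<^sup>2 -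
      1/4 * (norm (v x - w x))\<^sup>2 +
      1 / (8 * (1 + \<omega>\<^sup>2)) * (norm (u x - v x + \<omega> *\<^sub>R (v x - w x)))\<^sup>2 +
      1 / (8 * (1 + \<omega>\<^sup>2)) * (norm (u x - ((1 + \<omega>) *\<^sub>R v x - \<omega> *\<^sub>R w x)))\<^sup>2 \<partial>lebesgue_on \<Omega>) \<le>
    (\<integral>x. (u x - v x) \<bullet> u x \<partial>lebesgue_on \<Omega>)"
    by (intro integral_mono BE_AB2_energy_pointwise Bochner_Integration.integrable_add
        Bochner_Integration.integrable_diff integrable_mult_right int L2_inner_integrable L2_diff assms)
  then show ?thesis
    unfolding L2norm_sq L2ip_def
    by (simp only: int Bochner_Integration.integral_add Bochner_Integration.integral_diff integral_mult_right_zero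
        Bochner_Integration.integrable_add Bochner_Integration.integrable_diff integrable_mult_right)
qed

text \<open>The scalar core of one time step. Here \<open>g\<close>, \<open>gE\<close> and
  \<open>d\<close> are the norms of the gradients of U and E and of D itself, \<open>X\<close> is
  the convective constant, \<open>F\<close> the dual norm of the forcing, and \<open>A\<close>
  collects the energy terms other than the dissipation of D. The convective term and the forcing
  each consume a quarter of the viscous term; a further quarter stays on the left.\<close>

lemma energy_step_real:
  fixes a b d f g \<tau> \<nu> h :: real
  assumes pos: "\<tau> > 0" "\<nu> > 0" "h > 0" "g \<ge> 0"
    and scheme: "a / \<tau> + \<nu> * g\<^sup>2 + b = f"
    and a: "A + 1 / (8 * (1 + \<omega>\<^sup>2)) * d\<^sup>2 \<le> a"
    and b: "\<bar>b\<bar> \<le> X * gE * g * d" and X: "X\<^sup>2 = K / h"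
    and cfl: "1 - 8 * K * \<tau> * (1 + \<omega>\<^sup>2) / (\<nu> * h) * gE\<^sup>2 \<ge> 0"
    and f: "f \<le> F * g"
  shows "A + \<nu> / 4 * (\<tau> * g\<^sup>2) \<le> \<tau> / \<nu> * F\<^sup>2"
proof -
  define q where "q = 1 + \<omega>\<^sup>2"
  have q: "q > 0"
    unfolding q_def by (simp add: add_pos_nonneg)
  have scheme': "a + \<tau> * \<nu> * g\<^sup>2 + \<tau> * b = \<tau> * f"
    using scheme pos(1) by (simp add: field_simps)
  \<comment> \<open>Young's inequality, weighted so that the coefficient of \<open>d\<^sup>2\<close>
    is exactly the available dissipation \<open>1 / (8 * q)\<close>.\<close>
  have "0 \<le> (d / (4 * q) - \<tau> * (X * gE * g))\<^sup>2 * (2 * q)"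
    using q by simp
  also have "\<dots> = 1 / (8 * q) * d\<^sup>2 - \<tau> * (X * gE * g * d) + 2 * q * \<tau>\<^sup>2 * X\<^sup>2 * gE\<^sup>2 * g\<^sup>2"
    using q by (simp add: power2_eq_square field_simps)
  finally have young: "\<tau> * (X * gE * g * d) \<le> 1 / (8 * q) * d\<^sup>2 + 2 * q * \<tau>\<^sup>2 * X\<^sup>2 * gE\<^sup>2 * g\<^sup>2"
    by simp
  \<comment> \<open>Here the 8 of the stability constant arises: comparing the Young remainder with
    a quarter of the viscous term leaves the factor
    \<open>8 * K * \<tau> * q / (\<nu> * h) * gE\<^sup>2\<close>, which the step size condition
    bounds by 1.\<close>
  have "2 * q * \<tau>\<^sup>2 * X\<^sup>2 * gE\<^sup>2 * g\<^sup>2 = (\<nu> / 4 * \<tau> * g\<^sup>2) * (8 * K * \<tau> * q / (\<nu> * h) * gE\<^sup>2)"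
    unfolding X using pos by (simp add: power2_eq_square field_simps)
  also have "\<dots> \<le> (\<nu> / 4 * \<tau> * g\<^sup>2) * 1"
    using cfl pos unfolding q_def by (intro mult_left_mono) auto
  finally have small: "2 * q * \<tau>\<^sup>2 * X\<^sup>2 * gE\<^sup>2 * g\<^sup>2 \<le> \<nu> / 4 * \<tau> * g\<^sup>2"
    by simp
  have "\<tau> * - b \<le> \<tau> * (X * gE * g * d)"
    using b pos(1) by (intro mult_left_mono) auto
  then have tb: "- (\<tau> * b) \<le> 1 / (8 * q) * d\<^sup>2 + \<nu> / 4 * \<tau> * g\<^sup>2"
    using young small by simp
  have "0 \<le> (F - \<nu> / 2 * g)\<^sup>2 / \<nu>"
    using pos by simp
  also have "\<dots> = F\<^sup>2 / \<nu> - F * g + \<nu> / 4 * g\<^sup>2"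
    using pos by (simp add: power2_eq_square field_simps)
  finally have "f \<le> F\<^sup>2 / \<nu> + \<nu> / 4 * g\<^sup>2"
    using f by simp
  then have "\<tau> * f \<le> \<tau> * (F\<^sup>2 / \<nu> + \<nu> / 4 * g\<^sup>2)"
    using pos by (intro mult_left_mono) auto
  also have "\<dots> = \<tau> / \<nu> * F\<^sup>2 + \<nu> / 4 * \<tau> * g\<^sup>2"
    by (simp add: algebra_simps)
  finally have "\<tau> * f \<le> \<tau> / \<nu> * F\<^sup>2 + \<nu> / 4 * \<tau> * g\<^sup>2" .
  moreover have "0 \<le> \<nu> / 4 * \<tau> * g\<^sup>2" "\<tau> * \<nu> * g\<^sup>2 = 4 * (\<nu> / 4 * \<tau> * g\<^sup>2)" "\<nu> / 4 * (\<tau> * g\<^sup>2) = \<nu> / 4 * \<tau> * g\<^sup>2"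
    using pos by simp_all
  ultimately show ?thesis
    using scheme' a tb unfolding q_def by linarith
qed

lemma BE_AB2_energy_step:
  fixes \<Omega> :: "(real^'d) set"
  assumes dim: "CARD('d) = 2 \<or> CARD('d) = 3" and \<Omega>: "\<Omega> \<in> sets lebesgue" "\<Omega> \<subseteq> cball 0 R" "R \<ge> 0"
    and K: "K = (1 + real CARD('d) / 2)\<^sup>2 * sqrt (4096 + 256 * R\<^sup>2) * Cinv" and Cinv: "Cinv > 0"
    and FE: "FE_pair \<Omega> h Cinv \<beta> Xh Qh" and \<nu>: "\<nu> > 0" and grid: "time_grid t N"
    and f: "Hminus1 \<Omega> (f (n + 1))" and VSS: "VSS_BE_AB2 \<Omega> Xh Qh \<nu> t f N u p"
    and n: "n \<in> {1..N-1}"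
    and cfl: "1 - 8 * K * dt t n * (1 + (ratio t n)\<^sup>2) / (\<nu> * h) * (L2norm \<Omega> (wgrad \<Omega> (Ext t u n)))\<^sup>2 \<ge> 0"
  shows "1/2 * (L2norm \<Omega> (u (n + 1)))\<^sup>2 + 1/4 * (L2norm \<Omega> (\<lambda>x. u (n + 1) x - u n x))\<^sup>2 +
      \<nu>/4 * (dt t n * (L2norm \<Omega> (wgrad \<Omega> (u (n + 1))))\<^sup>2) +
      1 / (8 * (1 + (ratio t n)\<^sup>2)) *
        (L2norm \<Omega> (\<lambda>x. u (n + 1) x - u n x + ratio t n *\<^sub>R (u n x - u (n - 1) x)))\<^sup>2 \<le>
    dt t n / \<nu> * (dualnorm \<Omega> (f (n + 1)))\<^sup>2 + 1/2 * (L2norm \<Omega> (u n))\<^sup>2 +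
      1/4 * (L2norm \<Omega> (\<lambda>x. u n x - u (n - 1) x))\<^sup>2"
proof -
  obtain BX where BX: "finite BX" "BX \<subseteq> H10 \<Omega>" "Xh = fspan BX" and h: "h > 0"
      and inv: "\<And>v. v \<in> Xh \<Longrightarrow> L2norm \<Omega> (wgrad \<Omega> v) \<le> Cinv / h * L2norm \<Omega> v"
    using FE unfolding FE_pair_def by blast
  have Xh: "v \<in> H10 \<Omega>" if "v \<in> Xh" for v
    using that BX fspan_subset_H10[OF \<Omega>(1) BX(1,2)] by blast
  have lc: "(\<lambda>x. a *\<^sub>R v x + b *\<^sub>R w x) \<in> Xh" if "v \<in> Xh" "w \<in> Xh" for a b v w
    using fspan_lincomb that BX(3) by blast
  \<comment> \<open>The scheme at index n places \<open>u (n + 1)\<close> in the space, so it covers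
    k from 2 on; the two initial values are given separately.\<close>
  have uX: "u k \<in> Xh" if "k \<le> N" for k
  proof (cases "k < 2")
    case True
    then have "k = 0 \<or> k = 1"
      by auto
    then show ?thesis
      using VSS unfolding VSS_BE_AB2_def by auto
  next
    case False
    then have "k - 1 \<in> {1..N-1}" "k - 1 + 1 = k"
      using that by auto
    then show ?thesis
      using VSS unfolding VSS_BE_AB2_def by metis
  qed
  have nN: "n + 1 \<le> N" "n \<le> N" "n - 1 \<le> N" "n < N"
    using n by auto
  define U V W \<omega> E D where "U = u (n + 1)" and "V = u n" and "W = u (n - 1)" and "\<omega> = ratio t n"
    and "E = Ext t u n" and "D = (\<lambda>x. U x - ((1 + \<omega>) *\<^sub>R V x - \<omega> *\<^sub>R W x))"
  have X: "U \<in> Xh" "V \<in> Xh" "W \<in> Xh"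
    unfolding U_def V_def W_def using uX nN by auto
  have Eeq: "E = (\<lambda>x. (1 + \<omega>) *\<^sub>R V x - \<omega> *\<^sub>R W x)"
    unfolding E_def Ext_def V_def W_def \<omega>_def ..
  have EX: "E \<in> Xh"
    using lc[OF X(2,3), of "1 + \<omega>" "- \<omega>"] unfolding Eeq by simp
  \<comment> \<open>The extrapolation error is itself a discrete field, so the inverse inequality
    may be applied to it.\<close>
  have DX: "D \<in> Xh"
  proof -
    have "D = (\<lambda>x. 1 *\<^sub>R U x + (- 1) *\<^sub>R E x)"
      by (simp add: D_def Eeq algebra_simps)
    then show ?thesis
      using lc[OF X(1) EX] by (simp only:)
  qed
  note rel = H10_rel_wgrad[OF Xh[OF X(1)]] H10_rel_wgrad[OF Xh[OF EX]] H10_rel_wgrad[OF Xh[OF DX]]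
  have L2: "L2 \<Omega> U" "L2 \<Omega> V" "L2 \<Omega> W"
    using X by (auto intro: H10_rel_L2(1)[OF H10_rel_wgrad[OF Xh]])
  have \<tau>: "dt t n > 0"
    using grid nN(4) unfolding time_grid_def dt_def by simp
  have test: "L2ip \<Omega> (\<lambda>x. (1 / dt t n) *\<^sub>R (U x - V x)) U + \<nu> * L2ip \<Omega> (wgrad \<Omega> U) (wgrad \<Omega> U) +
      bstar \<Omega> E E U - L2ip \<Omega> (p (n + 1)) (wdiv \<Omega> U) = f (n + 1) U"
    and pressure: "L2ip \<Omega> (wdiv \<Omega> U) (p (n + 1)) = 0"
    using VSS n X(1) unfolding VSS_BE_AB2_def U_def V_def E_def by blast+
  \<comment> \<open>The discrete divergence constraint, tested with the pressure itself, removes the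
    pressure from the energy balance.\<close>
  have "L2ip \<Omega> (p (n + 1)) (wdiv \<Omega> U) = 0"
    using pressure unfolding L2ip_def by (simp add: mult.commute)
  moreover have "L2ip \<Omega> (wgrad \<Omega> U) (wgrad \<Omega> U) = (L2norm \<Omega> (wgrad \<Omega> U))\<^sup>2"
    unfolding L2norm_sq L2ip_def by (simp add: power2_norm_eq_inner)
  moreover have "L2ip \<Omega> (\<lambda>x. (1 / dt t n) *\<^sub>R (U x - V x)) U = L2ip \<Omega> (\<lambda>x. U x - V x) U / dt t n"
    unfolding L2ip_def by simp
  ultimately have scheme: "L2ip \<Omega> (\<lambda>x. U x - V x) U / dt t n + \<nu> * (L2norm \<Omega> (wgrad \<Omega> U))\<^sup>2 + bstar \<Omega> E E U =
      f (n + 1) U"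
    using test by simp
  \<comment> \<open>The gradients of E, U and D are selected independently by \<open>wgrad\<close>;
    the estimate relates only the fields, through \<open>U - E = D\<close>.\<close>
  have b: "\<bar>bstar \<Omega> E E U\<bar> \<le> ((1 + real CARD('d) / 2) * sqrt (sqrt (4096 + 256 * R\<^sup>2) * (Cinv / h))) *
      L2norm \<Omega> (wgrad \<Omega> E) * L2norm \<Omega> (wgrad \<Omega> U) * L2norm \<Omega> D"
    unfolding bstar_def
    by (rule skew_trilinear_estimate[OF dim \<Omega> rel(2,1,3) _ inv[OF DX]]) (simp add: D_def Eeq)
  have X2: "((1 + real CARD('d) / 2) * sqrt (sqrt (4096 + 256 * R\<^sup>2) * (Cinv / h)))\<^sup>2 = K / h"
    using Cinv h by (simp add: K power_mult_distrib)
  have a: "(1/2 * (L2norm \<Omega> U)\<^sup>2 - 1/2 * (L2norm \<Omega> V)\<^sup>2 + 1/4 * (L2norm \<Omega> (\<lambda>x. U x - V x))\<^sup>2 -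
      1/4 * (L2norm \<Omega> (\<lambda>x. V x - W x))\<^sup>2 +
      1 / (8 * (1 + \<omega>\<^sup>2)) * (L2norm \<Omega> (\<lambda>x. U x - V x + \<omega> *\<^sub>R (V x - W x)))\<^sup>2) +
      1 / (8 * (1 + \<omega>\<^sup>2)) * (L2norm \<Omega> D)\<^sup>2 \<le> L2ip \<Omega> (\<lambda>x. U x - V x) U"
    unfolding D_def by (rule BE_AB2_energy_L2[OF L2])
  from energy_step_real[OF \<tau> \<nu> h L2norm_nonneg scheme a b X2
      cfl[folded E_def \<omega>_def] le_dualnorm[OF f Xh[OF X(1)]]]
  show ?thesis
    unfolding U_def V_def W_def \<omega>_def by linarith
qed

theorem mainTheorem2:
  fixes \<Omega> :: "(real^'d) set" and Cinv \<beta> :: real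
  assumes dim: "CARD('d) = 2 \<or> CARD('d) = 3"
    and dom: "polyhedral_domain \<Omega>"
    and Cinv: "Cinv > 0" and beta: "\<beta> > 0"
  shows "\<exists>Cstab > 0. \<forall>h Xh Qh \<nu> t f N u p.
     FE_pair \<Omega> h Cinv \<beta> Xh Qh \<and> \<nu> > 0 \<and> N > 1 \<and> time_grid t N \<and>
     (\<forall>n\<in>{1..N-1}. Hminus1 \<Omega> (f (n+1))) \<and>
     VSS_BE_AB2 \<Omega> Xh Qh \<nu> t f N u p \<and>
     (\<forall>n\<in>{1..N-1}. 1 - Cstab * dt t n * (1 + (ratio t n)\<^sup>2) / (\<nu> * h)
                         * (L2norm \<Omega> (wgrad \<Omega> (Ext t u n)))\<^sup>2 \<ge> 0)
     \<longrightarrow>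
     1/2 * (L2norm \<Omega> (u N))\<^sup>2 + 1/4 * (L2norm \<Omega> (\<lambda>x. u N x - u (N-1) x))\<^sup>2
     + \<nu>/4 * (\<Sum>n=1..N-1. dt t n * (L2norm \<Omega> (wgrad \<Omega> (u (n+1))))\<^sup>2)
     + (\<Sum>n=1..N-1. 1 / (8 * (1 + (ratio t n)\<^sup>2)) *
          (L2norm \<Omega> (\<lambda>x. u (n+1) x - u n x + ratio t n *\<^sub>R (u n x - u (n-1) x)))\<^sup>2)
     \<le> (\<Sum>n=1..N-1. dt t n / \<nu> * (dualnorm \<Omega> (f (n+1)))\<^sup>2)
       + 1/2 * (L2norm \<Omega> (u 1))\<^sup>2 + 1/4 * (L2norm \<Omega> (\<lambda>x. u 1 x - u 0 x))\<^sup>2"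
proof -
  have "open \<Omega>" "bounded \<Omega>"
    using dom unfolding polyhedral_domain_def by auto
  then have \<Omega>: "\<Omega> \<in> sets lebesgue"
    by auto
  obtain R where R: "\<Omega> \<subseteq> cball 0 R" "R \<ge> 0"
    using \<open>bounded \<Omega>\<close> unfolding bounded_pos by (force simp: subset_iff)
  \<comment> \<open>Apart from the dimension, \<open>K\<close> depends only on \<open>Cinv\<close>
    and a radius \<open>R\<close> bounding the domain; it is fixed before the mesh size, the time
    grid, the viscosity and the solution.\<close>
  define K where "K = (1 + real CARD('d) / 2)\<^sup>2 * sqrt (4096 + 256 * R\<^sup>2) * Cinv"
  have "K > 0"
    unfolding K_def using Cinv by (intro mult_pos_pos) (auto simp: add_pos_nonneg)
  show ?thesis
  proof (intro exI[of _ "8 * K"] conjI allI impI)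
    show "8 * K > 0"
      using \<open>K > 0\<close> by simp
  next
    fix h Xh Qh \<nu> t f N u p
    assume asm: "FE_pair \<Omega> h Cinv \<beta> Xh Qh \<and> \<nu> > 0 \<and> N > 1 \<and> time_grid t N \<and>
     (\<forall>n\<in>{1..N-1}. Hminus1 \<Omega> (f (n+1))) \<and>
     VSS_BE_AB2 \<Omega> Xh Qh \<nu> t f N u p \<and>
     (\<forall>n\<in>{1..N-1}. 1 - 8 * K * dt t n * (1 + (ratio t n)\<^sup>2) / (\<nu> * h)
                         * (L2norm \<Omega> (wgrad \<Omega> (Ext t u n)))\<^sup>2 \<ge> 0)"
    \<comment> \<open>Stated for every intermediate time so that induction applies: the terms with
      factors 1/2 and 1/4 telescope, the others accumulate. At \<open>m = 0\<close> both sides are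
      the initial energy.\<close>
    have sum: "1/2 * (L2norm \<Omega> (u (m + 1)))\<^sup>2 + 1/4 * (L2norm \<Omega> (\<lambda>x. u (m + 1) x - u m x))\<^sup>2
     + \<nu>/4 * (\<Sum>n=1..m. dt t n * (L2norm \<Omega> (wgrad \<Omega> (u (n+1))))\<^sup>2)
     + (\<Sum>n=1..m. 1 / (8 * (1 + (ratio t n)\<^sup>2)) *
          (L2norm \<Omega> (\<lambda>x. u (n+1) x - u n x + ratio t n *\<^sub>R (u n x - u (n-1) x)))\<^sup>2)
     \<le> (\<Sum>n=1..m. dt t n / \<nu> * (dualnorm \<Omega> (f (n+1)))\<^sup>2)
       + 1/2 * (L2norm \<Omega> (u 1))\<^sup>2 + 1/4 * (L2norm \<Omega> (\<lambda>x. u 1 x - u 0 x))\<^sup>2" if "m \<le> N - 1" for m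
      using that
    proof (induction m)
      case 0
      then show ?case
        by simp
    next
      case (Suc m)
      have mem: "Suc m \<in> {1..N-1}"
        using Suc.prems by simp
      have step: "1/2 * (L2norm \<Omega> (u (Suc m + 1)))\<^sup>2 + 1/4 * (L2norm \<Omega> (\<lambda>x. u (Suc m + 1) x - u (Suc m) x))\<^sup>2 +
          \<nu>/4 * (dt t (Suc m) * (L2norm \<Omega> (wgrad \<Omega> (u (Suc m + 1))))\<^sup>2) +
          1 / (8 * (1 + (ratio t (Suc m))\<^sup>2)) * (L2norm \<Omega> (\<lambda>x. u (Suc m + 1) x - u (Suc m) x +
            ratio t (Suc m) *\<^sub>R (u (Suc m) x - u (Suc m - 1) x)))\<^sup>2 \<le>
        dt t (Suc m) / \<nu> * (dualnorm \<Omega> (f (Suc m + 1)))\<^sup>2 + 1/2 * (L2norm \<Omega> (u (Suc m)))\<^sup>2 +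
          1/4 * (L2norm \<Omega> (\<lambda>x. u (Suc m) x - u (Suc m - 1) x))\<^sup>2"
        using asm mem by (intro BE_AB2_energy_step[OF dim \<Omega> R K_def Cinv _ _ _ _ _ mem]) blast+
      have IH: "1/2 * (L2norm \<Omega> (u (Suc m)))\<^sup>2 + 1/4 * (L2norm \<Omega> (\<lambda>x. u (Suc m) x - u (Suc m - 1) x))\<^sup>2
         + \<nu>/4 * (\<Sum>n=1..m. dt t n * (L2norm \<Omega> (wgrad \<Omega> (u (n+1))))\<^sup>2)
         + (\<Sum>n=1..m. 1 / (8 * (1 + (ratio t n)\<^sup>2)) *
              (L2norm \<Omega> (\<lambda>x. u (n+1) x - u n x + ratio t n *\<^sub>R (u n x - u (n-1) x)))\<^sup>2)
         \<le> (\<Sum>n=1..m. dt t n / \<nu> * (dualnorm \<Omega> (f (n+1)))\<^sup>2)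
           + 1/2 * (L2norm \<Omega> (u 1))\<^sup>2 + 1/4 * (L2norm \<Omega> (\<lambda>x. u 1 x - u 0 x))\<^sup>2"
        using Suc.IH Suc.prems by simp
      have range: "(\<Sum>n=1..Suc m. g n) = (\<Sum>n=1..m. g n) + g (Suc m)" for g :: "nat \<Rightarrow> real"
        by simp
      show ?case
        unfolding range distrib_left[of "\<nu> / 4"] using step IH by linarith
    qed
    have "N - 1 + 1 = N"
      using asm by simp
    with sum[of "N - 1"] show "1/2 * (L2norm \<Omega> (u N))\<^sup>2 + 1/4 * (L2norm \<Omega> (\<lambda>x. u N x - u (N-1) x))\<^sup>2
     + \<nu>/4 * (\<Sum>n=1..N-1. dt t n * (L2norm \<Omega> (wgrad \<Omega> (u (n+1))))\<^sup>2)
     + (\<Sum>n=1..N-1. 1 / (8 * (1 + (ratio t n)\<^sup>2)) *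
          (L2norm \<Omega> (\<lambda>x. u (n+1) x - u n x + ratio t n *\<^sub>R (u n x - u (n-1) x)))\<^sup>2)
     \<le> (\<Sum>n=1..N-1. dt t n / \<nu> * (dualnorm \<Omega> (f (n+1)))\<^sup>2)
       + 1/2 * (L2norm \<Omega> (u 1))\<^sup>2 + 1/4 * (L2norm \<Omega> (\<lambda>x. u 1 x - u 0 x))\<^sup>2"
      by simp
  qed
qed

end
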